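(* Let $\mathbb{S}^2$ be the space of complex symmetric $2\times2$ matrices and let $X\subset\mathbb{P}\mathbb{S}^2$ be an irreducible curve of degree $>1$, not contained in $V(\det)$. Then $$\mathrm{MLD}_{\det}(X)=1\iff X=V\big(\det(K)-\mathrm{trace}(AK)^2\big)$$ for some symmetric matrix $A=\begin{pmatrix} a_{11} & a_{12} \\ a_{12} & a_{22} \end{pmatrix}\in\mathbb{S}^2$ of rank $1$ (and any symmetric matrix $A$ of rank $1$ may occur). The corresponding solution to the homaloidal PDE is given by $$\Phi_{X,\mathbb{S}^2,\det}(S)=4\left(\frac{a_{22}s_{11}+a_{11}s_{22}-2a_{12}s_{12}}{(s_{11}s_{22}-s_{12}^2)+(a_{22}s_{11}+a_{11}s_{22}-2a_{12}s_{12})^2}\right)^2 .$$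
   Context: $\mathbb{S}^2$ is identified with its dual via the trace pairing: $S\in\mathbb{S}^2$ corresponds to the linear form $K\mapsto\mathrm{trace}(SK)$. Elements of the dual are written $S=(s_{ij})$, elements of $\mathbb{S}^2$ are written $K=(\kappa_{ij})$. Under this identification the gradient of a function $\Phi$ on the dual space has entries $(\nabla_S\Phi)_{ij}=\frac{1}{2-\delta_{ij}}\frac{\partial\Phi}{\partial s_{ij}}$ (with $\delta_{ij}$ the Kronecker delta). Maximum likelihood degree, with $\mathcal{L}=\mathbb{S}^2$ and $F=\det$: $C_X\subset\mathcal{L}$ is the affine cone over $X$ and $C_X^\circ=(C_X)_{\mathrm{reg}}\setminus V(F)$. For $u\in\mathcal{L}^\ast$, $\ell_{F,u}(p)=\log F(p)-u(p)$, with differential $p\mapsto\frac{d_pF}{F(p)}-u$. Let $\xi_F=\{(x,u): x\text{ is a critical point of }\ell_{F,u}|_{C_X^\circ}\}\subset\mathcal{L}\times\mathcal{L}^\ast$. $\mathrm{MLD}_F(X)$ is the degree of the projection $\xi_F\to\mathcal{L}^\ast$ if it is dominant and $0$ otherwise. If $\mathrm{MLD}_F(X)=1$, then for general $u$ there is a unique critical point $\mathrm{MLE}_{X,\mathcal{L},F}(u)\in C_X^\circ$, rational in $u$. It is known that the varieties $X$ with $\mathrm{MLD}_F(X)=1$ are in bijection with the solutions $\Phi\colon\mathcal{L}^\ast\dashrightarrow\mathbb{C}$ (rational and homogeneous) of the homaloidal PDE $\Phi=F\circ(-\nabla\log\Phi)$; the solution $\Phi_{X,\mathcal{L},F}$ corresponding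 to $X$ satisfies $\mathrm{MLE}_{X,\mathcal{L},F}=-\nabla\log\Phi_{X,\mathcal{L},F}$, hence $\Phi_{X,\mathcal{L},F}=F\circ\mathrm{MLE}_{X,\mathcal{L},F}$. *)

theory Defs
  imports "HOL-Analysis.Analysis" "HOL-Computational_Algebra.Polynomial"
begin

section \<open>Complex symmetric matrices\<close>

type_synonym cmat = "complex^2^2"

definition Sym :: "cmat set" where
  "Sym = {K. transpose K = K}"

definition cmul :: "complex \<Rightarrow> cmat \<Rightarrow> cmat" (infixr "*\<^sub>c" 75) where
  "c *\<^sub>c K = (\<chi> i j. c * K $ i $ j)"

text \<open>The type of matrices carries only a real vector space structure in the library, so
  spans and dimensions over the complex numbers come from this interpretation.\<close>

global_interpretation cmat: vector_space cmul
  by unfold_locales (simp_all add: cmul_def vec_eq_iff algebra_simps)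


section \<open>Polynomials on symmetric matrices\<close>

text \<open>The coordinate ring of the three-dimensional space \<^term>\<open>Sym\<close> is the ring of
  polynomials in the entries (1,1), (1,2), (2,2), encoded as iterated univariate polynomials:
  the outermost variable stands for the entry (1,1), the innermost one for the entry (2,2).\<close>

type_synonym poly3 = "complex poly poly poly"

definition peval :: "poly3 \<Rightarrow> cmat \<Rightarrow> complex" where
  "peval f K = poly (poly (poly f [:[:K $ 1 $ 1:]:]) [:K $ 1 $ 2:]) (K $ 2 $ 2)"

definition homogeneous :: "nat \<Rightarrow> poly3 \<Rightarrow> bool" where
  "homogeneous d f \<longleftrightarrow> (\<forall>i j k. coeff (coeff (coeff f i) j) k \<noteq> 0 \<longrightarrow> i + j + k = d)"

text \<open>A property holds for general S if it holds on a nonempty Zariski open subset of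
  \<^term>\<open>Sym\<close>; such a set contains the complement of a hypersurface.\<close>

definition generically :: "(cmat \<Rightarrow> bool) \<Rightarrow> bool" where
  "generically P \<longleftrightarrow> (\<exists>g. g \<noteq> 0 \<and> (\<forall>S\<in>Sym. peval g S \<noteq> 0 \<longrightarrow> P S))"

definition zariski_dense :: "cmat set \<Rightarrow> bool" where
  "zariski_dense U \<longleftrightarrow> (\<forall>g. (\<forall>S\<in>U. peval g S = 0) \<longrightarrow> g = 0)"


section \<open>Plane curves and their affine cones\<close>

definition proj_points :: "cmat set set" where
  "proj_points = {cmat.span {K} | K. K \<in> Sym \<and> K \<noteq> 0}"

definition proj_zeros :: "(cmat \<Rightarrow> complex) \<Rightarrow> cmat set set" where
  "proj_zeros f = {x \<in> proj_points. \<forall>K\<in>x. f K = 0}"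

definition irreducible_curve :: "nat \<Rightarrow> cmat set set \<Rightarrow> bool" where
  "irreducible_curve d X \<longleftrightarrow>
     (\<exists>f. irreducible f \<and> homogeneous d f \<and> X = proj_zeros (peval f))"

definition affine_cone :: "cmat set set \<Rightarrow> cmat set" where
  "affine_cone X = insert 0 (\<Union>X)"

definition differential :: "(cmat \<Rightarrow> complex) \<Rightarrow> cmat \<Rightarrow> cmat \<Rightarrow> complex" where
  "differential f p v = deriv (\<lambda>t. f (p + t *\<^sub>c v)) 0"

definition vanishing_ideal :: "cmat set \<Rightarrow> poly3 set" where
  "vanishing_ideal C = {f. \<forall>K\<in>C. peval f K = 0}"

definition tangent_space :: "cmat set \<Rightarrow> cmat \<Rightarrow> cmat set" where
  "tangent_space C p = {v \<in> Sym. \<forall>f\<in>vanishing_ideal C. differential (peval f) p v = 0}"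

text \<open>The argument n is the dimension of C. The cone over a curve has dimension 2.\<close>

definition regular_points :: "nat \<Rightarrow> cmat set \<Rightarrow> cmat set" where
  "regular_points n C = {p \<in> C. cmat.dim (tangent_space C p) = n}"

definition cone_open_part :: "cmat set set \<Rightarrow> cmat set" where
  "cone_open_part X = regular_points 2 (affine_cone X) - {K. det K = 0}"


section \<open>Maximum likelihood degree\<close>

text \<open>A linear form on \<^term>\<open>Sym\<close> is given by a symmetric matrix S via the trace pairing.\<close>

definition critical_point :: "cmat set set \<Rightarrow> cmat \<Rightarrow> cmat \<Rightarrow> bool" where
  "critical_point X S K \<longleftrightarrow>
     K \<in> cone_open_part X \<and>
     (\<forall>v\<in>tangent_space (affine_cone X) K. differential det K v / det K - trace (S ** v) = 0)"

definition likelihood_incidence :: "cmat set set \<Rightarrow> (cmat \<times> cmat) set" where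
  "likelihood_incidence X = {(K, S). S \<in> Sym \<and> critical_point X S K}"

text \<open>The degree of the projection of R to the second factor is the number of points in a
  general fibre. It is 0 by convention if the general fibre is infinite.\<close>

definition general_fibre_card :: "(cmat \<times> cmat) set \<Rightarrow> nat \<Rightarrow> bool" where
  "general_fibre_card R n \<longleftrightarrow>
     generically (\<lambda>S. finite {K. (K, S) \<in> R} \<and> card {K. (K, S) \<in> R} = n)"

definition proj_degree :: "(cmat \<times> cmat) set \<Rightarrow> nat" where
  "proj_degree R = (if \<exists>n. general_fibre_card R n then THE n. general_fibre_card R n else 0)"

definition MLD :: "cmat set set \<Rightarrow> nat" where
  "MLD X = (if zariski_dense (snd ` likelihood_incidence X)
            then proj_degree (likelihood_incidence X) else 0)"

text \<open>Only meaningful for general S and for X with \<^term>\<open>MLD X = 1\<close>.\<close>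

definition MLE :: "cmat set set \<Rightarrow> cmat \<Rightarrow> cmat" where
  "MLE X S = (THE K. (K, S) \<in> likelihood_incidence X)"


section \<open>The homaloidal PDE\<close>

text \<open>Rational functions are represented by total functions, to be read up to equality at
  general points.\<close>

definition homogeneous_rational :: "(cmat \<Rightarrow> complex) \<Rightarrow> bool" where
  "homogeneous_rational \<Phi> \<longleftrightarrow>
     (\<exists>p q m n. homogeneous m p \<and> homogeneous n q \<and> q \<noteq> 0 \<and>
        generically (\<lambda>S. \<Phi> S = peval p S / peval q S))"

text \<open>Direction of the partial derivative with respect to the coordinate (i,j) of a symmetric
  matrix: off the diagonal, the entries (i,j) and (j,i) vary together.\<close>

definition sym_unit :: "2 \<Rightarrow> 2 \<Rightarrow> cmat" where
  "sym_unit i j = (\<chi> k l. if {k, l} = {i, j} then 1 else 0)"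

definition grad :: "(cmat \<Rightarrow> complex) \<Rightarrow> cmat \<Rightarrow> cmat" where
  "grad \<Phi> S = (\<chi> i j. 1 / (2 - of_bool (i = j)) * differential \<Phi> S (sym_unit i j))"

text \<open>The gradient of the logarithm is taken as the logarithmic derivative, which does not
  depend on a branch.\<close>

definition grad_log :: "(cmat \<Rightarrow> complex) \<Rightarrow> cmat \<Rightarrow> cmat" where
  "grad_log \<Phi> S = (1 / \<Phi> S) *\<^sub>c grad \<Phi> S"

text \<open>The logarithm requires the solution not to be the zero function.\<close>

definition homaloidal_solution :: "(cmat \<Rightarrow> complex) \<Rightarrow> bool" where
  "homaloidal_solution \<Phi> \<longleftrightarrow> homogeneous_rational \<Phi> \<and>
     generically (\<lambda>S. \<Phi> S \<noteq> 0 \<and> \<Phi> S = det (- grad_log \<Phi> S))"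

definition corresponding_solution :: "cmat set set \<Rightarrow> (cmat \<Rightarrow> complex) \<Rightarrow> bool" where
  "corresponding_solution X \<Phi> \<longleftrightarrow> MLD X = 1 \<and> homaloidal_solution \<Phi> \<and>
     generically (\<lambda>S. MLE X S = - grad_log \<Phi> S)"

end

theory Submission
  imports Defs "HOL-Computational_Algebra.Polynomial_Factorial" "HOL-Computational_Algebra.Field_as_Ring"
    "HOL-Computational_Algebra.Fundamental_Theorem_Algebra"
    "HOL-Complex_Analysis.Cauchy_Integral_Theorem"
begin

text \<open>A point K of the curve F = 0 is critical for S up to scaling iff the linear form S vanishes at the
  point \<open>\<gamma>(K)\<close> where the tangent of the curve at K meets the polar line of K with respect to the conic
  det = 0. So the maximum likelihood degree is the number of points of the curve that \<open>\<gamma>\<close> maps to a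
  general line, and it is 1 only if \<open>\<gamma>\<close> maps the curve birationally onto a line B = 0. Then the curve is
  tangent to the pencil of conics \<open>det - t B\<^sup>2\<close>, that is, invariant under the one-parameter group of
  projectivities preserving det and B. If B = 0 meets det = 0 in two points, this group contains an
  involution that permutes the critical points, which contradicts uniqueness. Hence B has rank 1, the
  quotient \<open>det / B\<^sup>2\<close> is constant on the curve, and the curve is a member of the pencil. Conversely,
  for these conics the critical equations are solved explicitly.\<close>

section \<open>Nullstellensatz for hypersurfaces\<close>

text \<open>Tangent spaces are defined by all polynomials that vanish on the cone, so it must be
  known that this ideal is generated by the equation of the curve; hence the Nullstellensatz. The
  scale of a critical point is not a free unknown: Euler's relation for the quadratic form det
  forces the trace pairing of S and K to be 2. Uniqueness is only given for S outside a
  hypersurface. Instead of counting intersections, suitable S are found by picking a point of the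
  curve first and then the member of a pencil of linear forms that kills its image: a pencil that
  contains one good form has only finitely many bad ones, while the point moves freely. Invariance
  under the vector field alone does not force B to have rank 1, since \<open>det - t B^2\<close> is
  invariant for every B; the involution is what brings in uniqueness. It is the flow at a quarter of
  its imaginary period.\<close>

lemma irreducible_ideal_constant:
  fixes p g :: "'r::{factorial_ring_gcd,semiring_gcd_mult_normalize} poly"
  assumes irr: "irreducible p" and deg: "degree p > 0" and ndvd: "\<not> p dvd g"
  shows "\<exists>u v r. r \<noteq> 0 \<and> u * p + v * g = [:r:]"
proof -
  have prime: "prime_elem p" using irr by (rule irreducible_imp_prime_elem_gcd)
  \<comment> \<open>The ideal need not be principal over the coefficient ring. Pseudo-division still
    makes a nonzero combination of least degree divide a nonzero constant multiple of every
    combination, without passing to a fraction field.\<close>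
  define I where "I = {h. h \<noteq> 0 \<and> (\<exists>u v. h = u * p + v * g)}"
  have pI: "p \<in> I"
  proof -
    have "p = 1 * p + 0 * g" by simp
    moreover have "p \<noteq> 0" using prime by auto
    ultimately show ?thesis unfolding I_def by blast
  qed
  define n where "n = (LEAST n. \<exists>h\<in>I. degree h = n)"
  have "\<exists>h\<in>I. degree h = n" unfolding n_def by (rule LeastI_ex) (use pI in blast)
  then obtain h where hI: "h \<in> I" and hn: "degree h = n" by blast
  have min: "n \<le> degree k" if "k \<in> I" for k
    unfolding n_def by (rule Least_le) (use that in blast)
  from hI obtain u v where h0: "h \<noteq> 0" and huv: "h = u * p + v * g" unfolding I_def by blast
  have div: "\<exists>c q. c \<noteq> 0 \<and> smult c k = h * q" if k: "k = a * p + b * g" for k a b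
  proof -
    obtain q r where qr: "pseudo_divmod k h = (q, r)" by (cases "pseudo_divmod k h")
    define c where "c = coeff h (degree h) ^ (Suc (degree k) - degree h)"
    have eq: "smult c k = h * q + r" and r: "r = 0 \<or> degree r < degree h"
      using pseudo_divmod[OF h0 qr] unfolding c_def by auto
    have "r = smult c k - h * q" using eq by simp
    also have "\<dots> = ([:c:] * a - u * q) * p + ([:c:] * b - v * q) * g"
      by (simp add: k huv algebra_simps smult_add_right)
    finally have rI: "r = ([:c:] * a - u * q) * p + ([:c:] * b - v * q) * g" .
    have "r = 0"
    proof (rule ccontr)
      assume "r \<noteq> 0"
      then have "r \<in> I" using rI unfolding I_def by blast
      then show False using min hn r \<open>r \<noteq> 0\<close> by fastforce
    qed
    moreover have "c \<noteq> 0" using h0 by (simp add: c_def)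
    ultimately show ?thesis using eq by auto
  qed
  have "degree h = 0"
  proof (rule ccontr)
    assume hd: "degree h \<noteq> 0"
    obtain c q where c: "c \<noteq> 0" "smult c p = h * q" using div[of p 1 0] by auto
    obtain c' q' where c': "c' \<noteq> 0" "smult c' g = h * q'" using div[of g 0 1] by auto
    have p0: "p \<noteq> 0" using prime by auto
    have "p dvd h * q" using c(2) by (metis dvd_smult dvd_refl)
    \<comment> \<open>If p divides q, then h divides a nonzero constant, against its positive
      degree. If p divides h, then p divides a constant multiple of g, hence g.\<close>
    then have "p dvd h \<or> p dvd q" by (rule prime_elem_dvd_multD[OF prime])
    then show False
    proof
      assume "p dvd q"
      then obtain s where "q = p * s" by blast
      then have "p * [:c:] = p * (h * s)" using c(2) by (simp add: algebra_simps)
      then have "[:c:] = h * s" using p0 by (metis mult_left_cancel)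
      moreover have "s \<noteq> 0" using calculation c(1) by auto
      ultimately have "degree [:c:] = degree h + degree s" using h0 degree_mult_eq by metis
      then show False using hd by simp
    next
      assume "p dvd h"
      then have "p dvd smult c' g" using c'(2) by simp
      then have "p dvd [:c':] * g" by simp
      then have "p dvd [:c':] \<or> p dvd g" using prime prime_elem_dvd_multD by blast
      then have "p dvd [:c':]" using ndvd by simp
      then show False using c'(1) deg dvd_imp_degree_le[of p "[:c':]"] by simp
    qed
  qed
  then obtain r where "h = [:r:]" by (metis degree_eq_zeroE)
  then show ?thesis using huv h0 by (metis pCons_eq_0_iff)
qed

definition eval_hom :: "('r::comm_ring_1 \<Rightarrow> complex) \<Rightarrow> bool" where
  "eval_hom e \<longleftrightarrow> e 0 = 0 \<and> e 1 = 1 \<and> (\<forall>a b. e (a + b) = e a + e b) \<and> (\<forall>a b. e (a * b) = e a * e b)"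

lemma map_poly_eval_hom_add:
  assumes "eval_hom e" shows "map_poly e (p + q) = map_poly e p + map_poly e q"
  using assms unfolding eval_hom_def by (intro poly_eqI) (simp add: coeff_map_poly)

lemma eval_hom_sum: "eval_hom e \<Longrightarrow> e (\<Sum>i\<in>A. f i) = (\<Sum>i\<in>A. e (f i))"
  unfolding eval_hom_def by (induction A rule: infinite_finite_induct) auto

lemma map_poly_eval_hom_mult:
  assumes "eval_hom e" shows "map_poly e (p * q) = map_poly e p * map_poly e q"
  using assms unfolding eval_hom_def
  by (intro poly_eqI) (simp add: coeff_map_poly coeff_mult eval_hom_sum[OF assms])

lemma eval_hom_poly:
  assumes "eval_hom e" shows "e (poly p c) = poly (map_poly e p) (e c)"
proof (induction p)
  case 0
  show ?case using assms by (simp add: eval_hom_def)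
next
  case (pCons a p)
  then show ?case using assms by (simp add: eval_hom_def map_poly_pCons)
qed

lemma eval_hom_poly_at:
  assumes "eval_hom e" shows "eval_hom (\<lambda>p. e (poly p c))"
  using assms by (simp add: eval_hom_def)

text \<open>Some coefficient of f survives under some \<open>E p\<close>, and the resulting nonzero
  univariate polynomial has a non-root. The map \<open>\<iota>\<close> embeds the scalars as
  constants of the ring.\<close>

lemma separating_step:
  fixes E :: "'p \<Rightarrow> 'r::{factorial_ring_gcd,semiring_gcd_mult_normalize} \<Rightarrow> complex"
  assumes hom: "\<And>p. eval_hom (E p)" and const: "\<And>p x. E p (\<iota> x) = x"
    and sep: "\<And>r. r \<noteq> 0 \<Longrightarrow> \<exists>p. E p r \<noteq> 0"
    and f: "f \<noteq> 0"
  shows "\<exists>p x. E p (poly f (\<iota> x)) \<noteq> 0"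
proof -
  from f obtain i where "coeff f i \<noteq> 0" by (metis leading_coeff_0_iff)
  then obtain p where "E p (coeff f i) \<noteq> 0" using sep by blast
  moreover have "E p 0 = 0" using hom by (simp add: eval_hom_def)
  ultimately have "map_poly (E p) f \<noteq> 0" by (metis coeff_0 coeff_map_poly)
  then obtain x where "poly (map_poly (E p) f) x \<noteq> 0" using poly_all_0_iff_0 by blast
  then show ?thesis using eval_hom_poly[OF hom] const by metis
qed

text \<open>For a family of evaluation homomorphisms, the principal Nullstellensatz (an irreducible
  element divides everything that vanishes on its zeros) passes from a ring to its polynomial ring;
  starting from the field itself, three such steps reach three variables.\<close>

lemma nullstellensatz_step:
  fixes E :: "'p \<Rightarrow> 'r::{factorial_ring_gcd,semiring_gcd_mult_normalize} \<Rightarrow> complex"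
  assumes hom: "\<And>p. eval_hom (E p)" and const: "\<And>p x. E p (\<iota> x) = x"
    and sep: "\<And>r. r \<noteq> 0 \<Longrightarrow> \<exists>p. E p r \<noteq> 0"
    and null: "\<And>r s. irreducible r \<Longrightarrow> (\<And>p. E p r = 0 \<Longrightarrow> E p s = 0) \<Longrightarrow> r dvd s"
    and irr: "irreducible f"
    and vanish: "\<And>p x. E p (poly f (\<iota> x)) = 0 \<Longrightarrow> E p (poly g (\<iota> x)) = 0"
  shows "f dvd g"
proof -
  have E0: "E p 0 = 0" for p using hom by (simp add: eval_hom_def)
  have ev: "E p (poly h (\<iota> x)) = poly (map_poly (E p) h) x" for p h x
    by (simp add: eval_hom_poly[OF hom] const)
  show ?thesis
  proof (cases "degree f = 0")
    case True
    then obtain r where r: "f = [:r:]" by (metis degree_eq_zeroE)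
    have irr_r: "irreducible r"
    proof (rule irreducibleI)
      show "r \<noteq> 0" using irr r by (metis not_irreducible_zero pCons_0_0)
      show "\<not> r dvd 1" using irr r by (metis irreducible_not_unit is_unit_const_poly_iff)
      fix a b assume "r = a * b"
      then have "f = [:a:] * [:b:]" using r by simp
      then have "[:a:] dvd 1 \<or> [:b:] dvd 1" by (rule irreducibleD[OF irr])
      then show "a dvd 1 \<or> b dvd 1" by (simp add: is_unit_const_poly_iff)
    qed
    \<comment> \<open>Over a zero p of r, the polynomial g vanishes for every value of the outer
      variable, so all its coefficients vanish at p.\<close>
    have "r dvd coeff g n" for n
    proof (rule null[OF irr_r])
      fix p assume "E p r = 0"
      then have "poly (map_poly (E p) g) x = 0" for x
        using vanish[of p x] r by (simp add: ev)
      then have "map_poly (E p) g = 0" by (intro poly_all_0_iff_0[THEN iffD1] allI)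
      then have "coeff (map_poly (E p) g) n = 0" by simp
      then show "E p (coeff g n) = 0" by (simp add: coeff_map_poly E0)
    qed
    then show ?thesis unfolding r by (simp add: const_poly_dvd_iff)
  next
    case False
    show ?thesis
    proof (rule ccontr)
      assume nd: "\<not> f dvd g"
      obtain u v r where r0: "r \<noteq> 0" and eq: "u * f + v * g = [:r:]"
        using irreducible_ideal_constant[OF irr _ nd] False by (metis neq0_conv)
      have "f \<noteq> 0" using irr by auto
      then have "r * lead_coeff f \<noteq> 0" using r0 by simp
      \<comment> \<open>Keeping the leading coefficient keeps the degree positive, so f has a root
        over p; f and g vanish there, but their combination r does not.\<close>
      then obtain p where "E p (r * lead_coeff f) \<noteq> 0" using sep[of "r * lead_coeff f"] by metis
      moreover have "E p (r * lead_coeff f) = E p r * E p (lead_coeff f)"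
        using hom by (simp add: eval_hom_def)
      ultimately have pr: "E p r \<noteq> 0" and pf: "E p (lead_coeff f) \<noteq> 0" by simp_all
      have "degree f \<le> degree (map_poly (E p) f)"
        using pf by (intro le_degree) (simp add: coeff_map_poly E0)
      then have "degree (map_poly (E p) f) > 0"
        using False by linarith
      then obtain x where x: "poly (map_poly (E p) f) x = 0"
        using alg_closed_imp_poly_has_root[of "map_poly (E p) f"] by auto
      then have y: "poly (map_poly (E p) g) x = 0" using vanish by (simp add: ev)
      have "poly (map_poly (E p) (u * f + v * g)) x = 0"
        using x y by (simp add: map_poly_eval_hom_add[OF hom] map_poly_eval_hom_mult[OF hom])
      then have "E p r = 0" unfolding eq using E0 by (simp add: map_poly_pCons)
      then show False using pr by simp
    qed
  qed
qed

definition ev3 :: "poly3 \<Rightarrow> complex^3 \<Rightarrow> complex" where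
  "ev3 f v = poly (poly (poly f [:[:v$1:]:]) [:v$2:]) (v$3)"

lemma nullstellensatz3_aux:
  shows "f \<noteq> 0 \<Longrightarrow> \<exists>v. ev3 f v \<noteq> 0"
    and "irreducible f \<Longrightarrow> (\<And>v. ev3 f v = 0 \<Longrightarrow> ev3 g v = 0) \<Longrightarrow> f dvd g"
proof -
  define E1 :: "complex \<Rightarrow> complex poly \<Rightarrow> complex" where "E1 = (\<lambda>z p. poly p z)"
  define E2 :: "complex \<times> complex \<Rightarrow> complex poly poly \<Rightarrow> complex"
    where "E2 = (\<lambda>(z,y) p. E1 z (poly p [:y:]))"
  have h0: "eval_hom (\<lambda>c::complex. c)" by (simp add: eval_hom_def)
  have h1: "eval_hom (E1 z)" for z unfolding E1_def by (simp add: eval_hom_def)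
  have h2: "eval_hom (E2 zy)" for zy
    unfolding E2_def by (cases zy) (simp add: eval_hom_poly_at[OF h1])
  have c1: "E1 z [:x:] = x" for z x by (simp add: E1_def)
  have c2: "E2 zy [:[:x:]:] = x" for zy x by (cases zy) (simp add: E2_def E1_def)
  have s1: "\<exists>z. E1 z r \<noteq> 0" if "r \<noteq> 0" for r
  proof -
    have "\<exists>(p::unit) x. poly r x \<noteq> 0"
      by (rule separating_step[where E = "\<lambda>_::unit. \<lambda>c. c" and \<iota> = "\<lambda>c. c"])
        (simp_all add: h0 that)
    then show ?thesis unfolding E1_def by simp
  qed
  have s2: "\<exists>zy. E2 zy r \<noteq> 0" if "r \<noteq> 0" for r
  proof -
    have "\<exists>z y. E1 z (poly r [:y:]) \<noteq> 0"
      by (rule separating_step[where E = E1 and \<iota> = "\<lambda>y. [:y:]"])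
        (simp_all add: h1 c1 s1 that)
    then show ?thesis unfolding E2_def by simp
  qed
  \<comment> \<open>A field has no irreducible elements, so the base case is vacuous.\<close>
  have n0: "r dvd s" if "irreducible r" for r s :: complex
    using that by (simp add: irreducible_def dvd_field_iff)
  have n1: "r dvd s" if irr: "irreducible r" and v: "\<And>z. E1 z r = 0 \<Longrightarrow> E1 z s = 0" for r s
  proof (rule nullstellensatz_step[where E = "\<lambda>_::unit. \<lambda>c. c" and \<iota> = "\<lambda>c. c"])
    show "poly s x = 0" if "poly r x = 0" for x using v[of x] that by (simp add: E1_def)
  qed (simp_all add: h0 n0 irr)
  have n2: "r dvd s" if irr: "irreducible r" and v: "\<And>zy. E2 zy r = 0 \<Longrightarrow> E2 zy s = 0" for r s
  proof (rule nullstellensatz_step[where E = E1 and \<iota> = "\<lambda>y. [:y:]"])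
    show "E1 z (poly s [:y:]) = 0" if "E1 z (poly r [:y:]) = 0" for z y
      using v[of "(z,y)"] that by (simp add: E2_def)
    show "r dvd s" if "irreducible r" "\<And>p. E1 p r = 0 \<Longrightarrow> E1 p s = 0" for r s
      using that by (rule n1)
  qed (simp_all add: h1 c1 s1 irr)
  have ev: "E2 (z,y) (poly h [:[:x:]:]) = ev3 h (vector [x,y,z])" for x y z h
    by (simp add: E2_def E1_def ev3_def)
  show "\<exists>v. ev3 f v \<noteq> 0" if "f \<noteq> 0"
  proof -
    have "\<exists>zy x. E2 zy (poly f [:[:x:]:]) \<noteq> 0"
      by (rule separating_step[where E = E2 and \<iota> = "\<lambda>x. [:[:x:]:]"])
        (simp_all only: h2 c2 s2 that not_False_eq_True)
    then show ?thesis by (auto simp: ev)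
  qed
  show "f dvd g" if irr: "irreducible f" and v: "\<And>v. ev3 f v = 0 \<Longrightarrow> ev3 g v = 0"
  proof (rule nullstellensatz_step[where E = E2 and \<iota> = "\<lambda>x. [:[:x:]:]"])
    show "E2 zy (poly g [:[:x:]:]) = 0" if "E2 zy (poly f [:[:x:]:]) = 0" for zy x
      using v[of "vector [x, snd zy, fst zy]"] that ev[of "fst zy" "snd zy"] by simp
    show "r dvd s" if "irreducible r" "\<And>p. E2 p r = 0 \<Longrightarrow> E2 p s = 0" for r s
      using that by (rule n2)
    show "\<exists>zy. E2 zy r \<noteq> 0" if "r \<noteq> 0" for r using that by (rule s2)
  qed (simp_all only: h2 c2 irr)
qed

lemmas ev3_nonzero = nullstellensatz3_aux(1)
lemmas nullstellensatz3 = nullstellensatz3_aux(2)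

section \<open>Polynomial functions on three-dimensional space\<close>

text \<open>Plain functions compose and restrict to lines more easily than iterated polynomials;
  \<open>polyfun_ev3\<close> and \<open>polyfun_imp_ev3\<close> translate where divisibility or the
  absence of zero divisors is needed.\<close>

inductive polyfun :: "(complex^3 \<Rightarrow> complex) \<Rightarrow> bool" where
  polyfun_const: "polyfun (\<lambda>v. c)"
| polyfun_coord: "polyfun (\<lambda>v. v $ i)"
| polyfun_add: "polyfun \<phi> \<Longrightarrow> polyfun \<psi> \<Longrightarrow> polyfun (\<lambda>v. \<phi> v + \<psi> v)"
| polyfun_mult: "polyfun \<phi> \<Longrightarrow> polyfun \<psi> \<Longrightarrow> polyfun (\<lambda>v. \<phi> v * \<psi> v)"

lemma polyfun_uminus: "polyfun \<phi> \<Longrightarrow> polyfun (\<lambda>v. - \<phi> v)"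
  using polyfun_mult[OF polyfun_const[of "-1"]] by simp

lemma polyfun_diff: "polyfun \<phi> \<Longrightarrow> polyfun \<psi> \<Longrightarrow> polyfun (\<lambda>v. \<phi> v - \<psi> v)"
  using polyfun_add[OF _ polyfun_uminus] by simp

lemma polyfun_power: "polyfun \<phi> \<Longrightarrow> polyfun (\<lambda>v. \<phi> v ^ n)"
  by (induction n) (auto intro: polyfun_const polyfun_mult)

lemma polyfun_prod: "(\<And>i. i \<in> A \<Longrightarrow> polyfun (\<phi> i)) \<Longrightarrow> polyfun (\<lambda>v. \<Prod>i\<in>A. \<phi> i v)"
  by (induction A rule: infinite_finite_induct) (auto intro: polyfun_const polyfun_mult)

lemmas polyfun_rules =
  polyfun_const polyfun_coord polyfun_add polyfun_mult polyfun_uminus polyfun_diff polyfun_power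
  polyfun_prod

lemma polyfun_ev3: "polyfun (ev3 f)"
proof -
  have 1: "polyfun (\<lambda>v. poly p (v$3))" for p
    by (induction p) (auto intro!: polyfun_rules)
  have 2: "polyfun (\<lambda>v. poly (poly p [:v$2:]) (v$3))" for p
    by (induction p) (auto intro!: polyfun_rules 1)
  have "polyfun (\<lambda>v. poly (poly (poly f [:[:v$1:]:]) [:v$2:]) (v$3))"
    by (induction f) (auto intro!: polyfun_rules 2)
  then show ?thesis by (simp add: ev3_def[abs_def])
qed

lemma polyfun_imp_ev3: "polyfun \<phi> \<Longrightarrow> \<exists>f. \<phi> = ev3 f"
proof (induction rule: polyfun.induct)
  case (polyfun_const c)
  have "(\<lambda>v. c) = ev3 [:[:[:c:]:]:]" by (simp add: ev3_def fun_eq_iff)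
  then show ?case by blast
next
  case (polyfun_coord i)
  have "(\<lambda>v. v$1) = ev3 [:0,1:]" "(\<lambda>v. v$2) = ev3 [:[:0,1:]:]" "(\<lambda>v. v$3) = ev3 [:[:[:0,1:]:]:]"
    by (simp_all add: ev3_def fun_eq_iff)
  then show ?case using exhaust_3[of i] by metis
next
  case (polyfun_add \<phi> \<psi>)
  then obtain f g where "\<phi> = ev3 f" "\<psi> = ev3 g" by blast
  then have "(\<lambda>v. \<phi> v + \<psi> v) = ev3 (f + g)" by (simp add: ev3_def fun_eq_iff)
  then show ?case by blast
next
  case (polyfun_mult \<phi> \<psi>)
  then obtain f g where "\<phi> = ev3 f" "\<psi> = ev3 g" by blast
  then have "(\<lambda>v. \<phi> v * \<psi> v) = ev3 (f * g)" by (simp add: ev3_def fun_eq_iff)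
  then show ?case by blast
qed

lemma ev3_mult [simp]: "ev3 (f * g) v = ev3 f v * ev3 g v"
  by (simp add: ev3_def)

lemma ev3_eq_0_iff: "(\<forall>v. ev3 f v = 0) \<longleftrightarrow> f = 0"
  using ev3_nonzero[of f] by (auto simp: ev3_def)

text \<open>Zariski density: an identity that holds wherever a nonzero polynomial does not vanish
  holds everywhere.\<close>

lemma polyfun_mult_eq_0:
  assumes "polyfun \<phi>" "polyfun \<psi>" "\<And>v. \<phi> v * \<psi> v = 0" "\<psi> w \<noteq> 0"
  shows "\<phi> v = 0"
proof -
  obtain f g where fg: "\<phi> = ev3 f" "\<psi> = ev3 g" using assms polyfun_imp_ev3 by blast
  then have "f * g = 0" using assms(3) ev3_eq_0_iff[of "f * g"] by simp
  moreover have "g \<noteq> 0" using assms(4) fg by (auto simp: ev3_def)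
  ultimately show ?thesis using fg by (simp add: ev3_def)
qed

lemma polyfun_line:
  assumes "polyfun \<phi>" shows "\<exists>h. \<forall>t. poly h t = \<phi> (P + t *s Q)"
  using assms
proof (induction rule: polyfun.induct)
  case (polyfun_const c)
  have "\<forall>t. poly [:c:] t = c" by simp
  then show ?case by blast
next
  case (polyfun_coord i)
  have "\<forall>t. poly [:P $ i, Q $ i:] t = (P + t *s Q) $ i" by simp
  then show ?case by blast
next
  case (polyfun_add \<phi> \<psi>)
  then obtain g h where "\<forall>t. poly g t = \<phi> (P + t *s Q)" "\<forall>t. poly h t = \<psi> (P + t *s Q)" by blast
  then have "\<forall>t. poly (g + h) t = \<phi> (P + t *s Q) + \<psi> (P + t *s Q)" by simp
  then show ?case by blast
next
  case (polyfun_mult \<phi> \<psi>)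
  then obtain g h where "\<forall>t. poly g t = \<phi> (P + t *s Q)" "\<forall>t. poly h t = \<psi> (P + t *s Q)" by blast
  then have "\<forall>t. poly (g * h) t = \<phi> (P + t *s Q) * \<psi> (P + t *s Q)" by simp
  then show ?case by blast
qed

section \<open>Polynomial maps and vector calculus of the projective plane\<close>

definition polymap :: "(complex^3 \<Rightarrow> complex^3) \<Rightarrow> bool" where
  "polymap G \<longleftrightarrow> (\<forall>i. polyfun (\<lambda>v. G v $ i))"

text \<open>Bilinear, without conjugation: the linear form u evaluated at v.\<close>

definition dot3 :: "complex^3 \<Rightarrow> complex^3 \<Rightarrow> complex" where
  "dot3 u v = u$1 * v$1 + u$2 * v$2 + u$3 * v$3"

text \<open>Projectively, the intersection point of two lines or the line joining two
  points.\<close>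

definition cross :: "complex^3 \<Rightarrow> complex^3 \<Rightarrow> complex^3" where
  "cross u v = vector [u$2 * v$3 - u$3 * v$2, u$3 * v$1 - u$1 * v$3, u$1 * v$2 - u$2 * v$1]"

lemma cross_nth [simp]:
  "cross u v $ 1 = u$2 * v$3 - u$3 * v$2" "cross u v $ 2 = u$3 * v$1 - u$1 * v$3"
  "cross u v $ 3 = u$1 * v$2 - u$2 * v$1"
  by (simp_all add: cross_def)

lemma polymap_iff:
  "polymap G \<longleftrightarrow> polyfun (\<lambda>v. G v $ 1) \<and> polyfun (\<lambda>v. G v $ 2) \<and> polyfun (\<lambda>v. G v $ 3)"
  by (simp add: polymap_def forall_3)

lemma polymap_nth: "polymap G \<Longrightarrow> polyfun (\<lambda>v. G v $ i)"
  by (simp add: polymap_def)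

lemma polyfun_dot3: "polymap G \<Longrightarrow> polymap H \<Longrightarrow> polyfun (\<lambda>v. dot3 (G v) (H v))"
  unfolding polymap_iff dot3_def by (intro polyfun_rules) auto

lemma polymap_cross: "polymap G \<Longrightarrow> polymap H \<Longrightarrow> polymap (\<lambda>v. cross (G v) (H v))"
  unfolding polymap_iff by (auto intro!: polyfun_rules)

lemma polymap_const: "polymap (\<lambda>v. P)"
  and polymap_id: "polymap (\<lambda>v. v)"
  and polymap_add: "polymap G \<Longrightarrow> polymap H \<Longrightarrow> polymap (\<lambda>v. G v + H v)"
  and polymap_diff: "polymap G \<Longrightarrow> polymap H \<Longrightarrow> polymap (\<lambda>v. G v - H v)"
  and polymap_scale: "polyfun \<phi> \<Longrightarrow> polymap H \<Longrightarrow> polymap (\<lambda>v. \<phi> v *s H v)"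
  unfolding polymap_iff by (auto intro!: polyfun_rules)

lemmas polymap_rules = polymap_const polymap_id polymap_add polymap_diff polymap_scale polymap_cross

lemma polyfun_compose:
  assumes "polyfun \<phi>" "polymap G" shows "polyfun (\<lambda>v. \<phi> (G v))"
  using assms(1) by (induction rule: polyfun.induct) (auto intro: polyfun_rules polymap_nth assms(2))

lemma polymap_compose: "polymap H \<Longrightarrow> polymap G \<Longrightarrow> polymap (\<lambda>v. H (G v))"
  unfolding polymap_iff using polyfun_compose[of "\<lambda>v. H v $ i" G for i]
  by (auto simp: polymap_iff)

text \<open>The chain rule is demanded along every complex curve, not only along lines, because the
  flow of the conic field is quadratic in its coefficient functions.\<close>

definition has_gradient :: "(complex^3 \<Rightarrow> complex) \<Rightarrow> (complex^3 \<Rightarrow> complex^3) \<Rightarrow> bool" where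
  "has_gradient \<phi> G \<longleftrightarrow> polymap G \<and>
     (\<forall>k k' t. (\<forall>i. ((\<lambda>t. k t $ i) has_field_derivative k' $ i) (at t)) \<longrightarrow>
        ((\<lambda>t. \<phi> (k t)) has_field_derivative dot3 (G (k t)) k') (at t))"

lemma has_gradientD:
  fixes k :: "complex \<Rightarrow> complex^3"
  assumes "has_gradient \<phi> G" "\<And>i. ((\<lambda>t. k t $ i) has_field_derivative k' $ i) (at t)"
  shows "((\<lambda>t. \<phi> (k t)) has_field_derivative dot3 (G (k t)) k') (at t)"
  using assms unfolding has_gradient_def by blast

lemma has_gradient_line:
  assumes "has_gradient \<phi> G"
  shows "((\<lambda>t. \<phi> (P + t *s Q)) has_field_derivative dot3 (G (P + t *s Q)) Q) (at t)"
  by (rule has_gradientD[OF assms]) (auto intro!: derivative_eq_intros)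

lemma has_gradient_add:
  assumes "has_gradient \<phi> G" "has_gradient \<psi> H"
  shows "has_gradient (\<lambda>v. \<phi> v + \<psi> v) (\<lambda>v. G v + H v)"
  unfolding has_gradient_def
proof (intro conjI allI impI)
  show "polymap (\<lambda>v. G v + H v)" using assms unfolding has_gradient_def by (intro polymap_rules) auto
  fix k :: "complex \<Rightarrow> complex^3" and k' t
  assume k: "\<forall>i. ((\<lambda>t. k t $ i) has_field_derivative k' $ i) (at t)"
  show "((\<lambda>t. \<phi> (k t) + \<psi> (k t)) has_field_derivative dot3 (G (k t) + H (k t)) k') (at t)"
    by (rule derivative_eq_intros has_gradientD[OF assms(1)] has_gradientD[OF assms(2)] k[rule_format])+
      (simp add: dot3_def algebra_simps)
qed

lemma has_gradient_mult:
  assumes "has_gradient \<phi> G" "has_gradient \<psi> H" "polyfun \<phi>" "polyfun \<psi>"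
  shows "has_gradient (\<lambda>v. \<phi> v * \<psi> v) (\<lambda>v. \<psi> v *s G v + \<phi> v *s H v)"
  unfolding has_gradient_def
proof (intro conjI allI impI)
  show "polymap (\<lambda>v. \<psi> v *s G v + \<phi> v *s H v)"
    using assms unfolding has_gradient_def by (intro polymap_rules) auto
  fix k :: "complex \<Rightarrow> complex^3" and k' t
  assume k: "\<forall>i. ((\<lambda>t. k t $ i) has_field_derivative k' $ i) (at t)"
  show "((\<lambda>t. \<phi> (k t) * \<psi> (k t)) has_field_derivative
      dot3 (\<psi> (k t) *s G (k t) + \<phi> (k t) *s H (k t)) k') (at t)"
    by (rule derivative_eq_intros has_gradientD[OF assms(1)] has_gradientD[OF assms(2)] k[rule_format])+
      (simp add: dot3_def algebra_simps)
qed

lemma polyfun_has_gradient: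
  assumes "polyfun \<phi>" shows "\<exists>G. has_gradient \<phi> G"
  using assms
proof (induction rule: polyfun.induct)
  case (polyfun_const c)
  have "has_gradient (\<lambda>v. c) (\<lambda>v. 0)"
    unfolding has_gradient_def by (auto intro!: polymap_rules derivative_eq_intros simp: dot3_def)
  then show ?case by blast
next
  case (polyfun_coord i)
  have "has_gradient (\<lambda>v. v $ i) (\<lambda>v. axis i 1)"
    unfolding has_gradient_def
    using exhaust_3[of i] by (auto intro!: polymap_rules simp: dot3_def axis_def)
  then show ?case by blast
next
  case (polyfun_add \<phi> \<psi>)
  then show ?case using has_gradient_add by blast
next
  case (polyfun_mult \<phi> \<psi>)
  then show ?case using has_gradient_mult by blast
qed

lemma polyfun_holomorphic:
  fixes k :: "complex \<Rightarrow> complex^3"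
  assumes "polyfun \<phi>" "\<And>i. (\<lambda>t. k t $ i) holomorphic_on S"
  shows "(\<lambda>t. \<phi> (k t)) holomorphic_on S"
  using assms(1) by (induction rule: polyfun.induct) (auto intro!: holomorphic_intros assms(2))

section \<open>The determinant as a quadratic form\<close>

definition det_form :: "complex^3 \<Rightarrow> complex" where
  "det_form v = v$1 * v$3 - v$2 * v$2"

text \<open>The gradient of \<open>det_form\<close>.\<close>

definition polar :: "complex^3 \<Rightarrow> complex^3" where
  "polar v = vector [v$3, - 2 * v$2, v$1]"

lemma polar_nth [simp]: "polar v $ 1 = v$3" "polar v $ 2 = - 2 * v$2" "polar v $ 3 = v$1"
  by (simp_all add: polar_def)

lemma polyfun_det_form: "polymap G \<Longrightarrow> polyfun (\<lambda>v. det_form (G v))"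
  unfolding det_form_def polymap_iff by (auto intro!: polyfun_rules)

lemma polymap_polar: "polymap G \<Longrightarrow> polymap (\<lambda>v. polar (G v))"
  unfolding polymap_iff by (auto intro!: polyfun_rules)

lemmas polyfun_intros = polyfun_rules polymap_rules polyfun_det_form polymap_polar polyfun_dot3

section \<open>Curves with a unique critical point\<close>

lemmas vec3_simps = vec_eq_iff forall_3 dot3_def det_form_def

lemma dot3_add_left [simp]: "dot3 (u + v) w = dot3 u w + dot3 v w"
  and dot3_add_right [simp]: "dot3 w (u + v) = dot3 w u + dot3 w v"
  and dot3_diff_left [simp]: "dot3 (u - v) w = dot3 u w - dot3 v w"
  and dot3_diff_right [simp]: "dot3 w (u - v) = dot3 w u - dot3 w v"
  and dot3_minus_left [simp]: "dot3 (- u) w = - dot3 u w"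
  and dot3_minus_right [simp]: "dot3 w (- u) = - dot3 w u"
  and dot3_scale_left [simp]: "dot3 (s *s u) w = s * dot3 u w"
  and dot3_scale_right [simp]: "dot3 w (s *s u) = s * dot3 w u"
  and dot3_zero [simp]: "dot3 0 w = 0" "dot3 w 0 = 0"
  by (simp_all add: dot3_def algebra_simps)

lemma dot3_nondegenerate: "u \<noteq> 0 \<Longrightarrow> \<exists>w. dot3 w u \<noteq> 0"
proof -
  assume "u \<noteq> 0"
  then obtain i where "u $ i \<noteq> 0" by (auto simp: vec_eq_iff)
  then have "dot3 (axis i 1) u \<noteq> 0" using exhaust_3[of i] by (auto simp: dot3_def axis_def)
  then show ?thesis by blast
qed

lemma cross_eq_0D:
  assumes "cross u v = 0" "v \<noteq> 0" shows "\<exists>s. u = s *s v"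
proof -
  obtain i where i: "v $ i \<noteq> 0" using assms(2) by (auto simp: vec_eq_iff)
  have e: "u$2 * v$3 = u$3 * v$2" "u$3 * v$1 = u$1 * v$3" "u$1 * v$2 = u$2 * v$1"
    using assms(1) by (simp_all add: vec3_simps)
  have "u = (u $ i / v $ i) *s v"
    using i e exhaust_3[of i] by (auto simp: vec3_simps field_simps)
  then show ?thesis by blast
qed

text \<open>Lagrange's identity, with a right side free of t. If a member of the pencil kills w, a
  nonzero right side ensures that it does not kill v, whichever t was needed.\<close>

lemma dot_cross_pencil:
  "dot3 (P + t *s Q) v * dot3 Q w - dot3 (P + t *s Q) w * dot3 Q v = dot3 (cross P Q) (cross v w)"
  by (simp add: dot3_def) algebra

lemma dot_polar_self: "dot3 (polar v) v = 2 * det_form v"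
  by (simp add: dot3_def det_form_def)

lemma poly_zero_off_0:
  fixes P :: "complex poly"
  assumes "\<And>s. s \<noteq> 0 \<Longrightarrow> poly P s = 0" shows "poly P s = 0"
proof -
  have "poly ([:0,1:] * P) s = 0" for s using assms[of s] by (cases "s = 0") auto
  then have "[:0,1:] * P = 0" by (intro poly_all_0_iff_0[THEN iffD1] allI)
  then show ?thesis by simp
qed

text \<open>Irreducibility enters in two forms: \<open>prime\<close> says that the zero set is
  irreducible, \<open>divides\<close> that its ideal is generated by F.\<close>

locale curve_cone =
  fixes F :: "complex^3 \<Rightarrow> complex" and a :: "complex^3 \<Rightarrow> complex^3" and d :: nat
  assumes polyfun_F: "polyfun F"
    and prime: "polyfun \<phi> \<Longrightarrow> polyfun \<psi> \<Longrightarrow> (\<And>v. F v = 0 \<Longrightarrow> \<phi> v * \<psi> v = 0) \<Longrightarrow>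
      (\<forall>v. F v = 0 \<longrightarrow> \<phi> v = 0) \<or> (\<forall>v. F v = 0 \<longrightarrow> \<psi> v = 0)"
    and divides: "polyfun \<phi> \<Longrightarrow> (\<And>v. F v = 0 \<Longrightarrow> \<phi> v = 0) \<Longrightarrow>
      \<exists>m. polyfun m \<and> (\<forall>v. \<phi> v = F v * m v)"
    and hom: "F (s *s v) = s ^ d * F v"
    and d: "d > 1"
    and F_nonzero: "\<exists>v. F v \<noteq> 0"
    and grad: "has_gradient F a"
    and not_det: "\<exists>v. F v = 0 \<and> det_form v \<noteq> 0"
begin

definition vanishes :: "(complex^3 \<Rightarrow> complex) \<Rightarrow> bool" where
  "vanishes \<phi> \<longleftrightarrow> (\<forall>v. F v = 0 \<longrightarrow> \<phi> v = 0)"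

lemma vanishes_mult:
  "polyfun \<phi> \<Longrightarrow> polyfun \<psi> \<Longrightarrow> vanishes (\<lambda>v. \<phi> v * \<psi> v) \<longleftrightarrow> vanishes \<phi> \<or> vanishes \<psi>"
  using prime[of \<phi> \<psi>] unfolding vanishes_def by auto

lemma vanishes_prod:
  assumes "finite A" "\<And>i. polyfun (\<phi> i)" "vanishes (\<lambda>v. \<Prod>i\<in>A. \<phi> i v)"
  shows "\<exists>i\<in>A. vanishes (\<phi> i)"
  using assms(1,3)
proof (induction A rule: finite_induct)
  case empty
  then show ?case using not_det by (auto simp: vanishes_def)
next
  case (insert x A)
  then show ?case
    using vanishes_mult[of "\<phi> x" "\<lambda>v. \<Prod>i\<in>A. \<phi> i v"] assms(2) polyfun_prod[of A \<phi>] by auto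
qed

text \<open>A rational function with finitely many values on an irreducible curve is constant: the
  product of \<open>\<phi> - t * \<psi>\<close> over these values t vanishes on the curve, so one
  factor does.\<close>

lemma vanishes_ratio:
  assumes "polyfun \<phi>" "polyfun \<psi>" "polyfun \<epsilon>" "h \<noteq> 0"
    and "\<And>v. F v = 0 \<Longrightarrow> \<psi> v = 0 \<or> \<epsilon> v = 0 \<or> poly h (\<phi> v / \<psi> v) = 0"
  shows "vanishes \<psi> \<or> vanishes \<epsilon> \<or> (\<exists>t. vanishes (\<lambda>v. \<phi> v - t * \<psi> v))"
proof -
  define R where "R = {t. poly h t = 0}"
  have fin: "finite R" unfolding R_def using assms(4) by (rule poly_roots_finite)
  have pf: "polyfun (\<lambda>v. \<Prod>t\<in>R. \<phi> v - t * \<psi> v)"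
    by (intro polyfun_intros assms)
  have "vanishes (\<lambda>v. \<psi> v * (\<epsilon> v * (\<Prod>t\<in>R. \<phi> v - t * \<psi> v)))"
    unfolding vanishes_def
  proof (intro allI impI)
    fix v assume "F v = 0"
    then consider "\<psi> v = 0" | "\<epsilon> v = 0" | "\<psi> v \<noteq> 0" "poly h (\<phi> v / \<psi> v) = 0"
      using assms(5) by blast
    then show "\<psi> v * (\<epsilon> v * (\<Prod>t\<in>R. \<phi> v - t * \<psi> v)) = 0"
    proof cases
      case 3
      then have "\<exists>t\<in>R. \<phi> v - t * \<psi> v = 0"
        by (intro bexI[of _ "\<phi> v / \<psi> v"]) (auto simp: R_def)
      then show ?thesis using fin by simp
    qed auto
  qed
  then have "vanishes \<psi> \<or> vanishes \<epsilon> \<or> vanishes (\<lambda>v. \<Prod>t\<in>R. \<phi> v - t * \<psi> v)"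
    using assms(2,3) pf by (simp add: vanishes_mult polyfun_mult)
  moreover have "polyfun (\<lambda>v. \<phi> v - t * \<psi> v)" for t
    by (intro polyfun_intros assms)
  ultimately show ?thesis
    using vanishes_prod[OF fin, of "\<lambda>t v. \<phi> v - t * \<psi> v"] by blast
qed

text \<open>The parameter t of the form that kills \<open>G v\<close> is a nonconstant rational
  function of v, because no member of the pencil kills all of G. It therefore avoids the finitely
  many roots of g on the pencil for some v, even outside the zeros of
  \<open>\<epsilon>\<close>.\<close>

lemma exists_pencil_member:
  assumes "polyfun g" "g P \<noteq> 0" "polymap G" "polyfun \<epsilon>" "\<not> vanishes \<epsilon>"
    and Q: "\<not> vanishes (\<lambda>v. dot3 Q (G v))"
    and PQ: "\<And>t. \<not> vanishes (\<lambda>v. dot3 (P + t *s Q) (G v))"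
  obtains v t where "F v = 0" "\<epsilon> v \<noteq> 0" "dot3 Q (G v) \<noteq> 0" "dot3 (P + t *s Q) (G v) = 0"
    "g (P + t *s Q) \<noteq> 0"
proof (rule ccontr)
  assume "\<not> thesis"
  then have no: "\<And>v t. F v = 0 \<Longrightarrow> \<epsilon> v \<noteq> 0 \<Longrightarrow> dot3 Q (G v) \<noteq> 0 \<Longrightarrow>
      dot3 (P + t *s Q) (G v) = 0 \<Longrightarrow> g (P + t *s Q) = 0"
    using that by blast
  obtain h where h: "\<And>t. poly h t = g (P + t *s Q)" using polyfun_line[OF assms(1)] by blast
  have "h \<noteq> 0" using h[of 0] assms(2) by auto
  have "vanishes (\<lambda>v. dot3 Q (G v)) \<or> vanishes \<epsilon> \<or>
      (\<exists>t. vanishes (\<lambda>v. - dot3 P (G v) - t * dot3 Q (G v)))"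
  proof (rule vanishes_ratio[OF _ _ _ \<open>h \<noteq> 0\<close>])
    fix v assume v: "F v = 0"
    show "dot3 Q (G v) = 0 \<or> \<epsilon> v = 0 \<or> poly h (- dot3 P (G v) / dot3 Q (G v)) = 0"
    proof (cases "dot3 Q (G v) = 0 \<or> \<epsilon> v = 0")
      case False
      then have "dot3 (P + (- dot3 P (G v) / dot3 Q (G v)) *s Q) (G v) = 0" by simp
      then show ?thesis using no[OF v] False h by metis
    qed auto
  qed (intro polyfun_intros assms)+
  then obtain t where "vanishes (\<lambda>v. - dot3 P (G v) - t * dot3 Q (G v))" using assms Q by blast
  moreover have "- dot3 P (G v) - t * dot3 Q (G v) = 0 \<Longrightarrow> dot3 (P + t *s Q) (G v) = 0" for v
    by (simp add: neg_eq_iff_add_eq_0)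
  ultimately have "vanishes (\<lambda>v. dot3 (P + t *s Q) (G v))" unfolding vanishes_def by blast
  then show False using PQ by blast
qed

lemma polymap_a: "polymap a"
  using grad by (simp add: has_gradient_def)

lemma F_scale_iff: "s \<noteq> 0 \<Longrightarrow> F (s *s v) = 0 \<longleftrightarrow> F v = 0"
  by (simp add: hom)

text \<open>The cofactor m is not known to be homogeneous, so degrees are compared along a ray:
  \<open>\<phi> v = s^(d - e) * F v * m (s v)\<close> for nonzero s, hence also for s = 0.\<close>

lemma vanishes_low_degree:
  assumes "polyfun \<phi>" "\<And>s v. s \<noteq> 0 \<Longrightarrow> \<phi> (s *s v) = s ^ e * \<phi> v" "e < d" "vanishes \<phi>"
  shows "\<phi> v = 0"
proof -
  obtain m where m: "polyfun m" "\<And>v. \<phi> v = F v * m v"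
    using divides[OF assms(1)] assms(4) unfolding vanishes_def by blast
  obtain h where h: "\<And>t. poly h t = m (0 + t *s v)" using polyfun_line[OF m(1)] by blast
  define P where "P = [:\<phi> v:] - smult (F v) (monom 1 (d - e) * h)"
  have "poly P s = 0" if "s \<noteq> 0" for s
  proof -
    have "s ^ e * \<phi> v = s ^ d * F v * m (s *s v)" using m(2)[of "s *s v"] assms(2)[OF that] hom by simp
    also have "s ^ d = s ^ e * s ^ (d - e)" using assms(3) by (simp flip: power_add)
    finally have "\<phi> v = s ^ (d - e) * F v * m (s *s v)" using that by simp
    then show ?thesis using h[of s] by (simp add: P_def poly_monom)
  qed
  then have "poly P 0 = 0" by (rule poly_zero_off_0)
  then show ?thesis using assms(3) by (simp add: P_def poly_monom)
qed

lemma a_scale: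
  assumes "s \<noteq> 0" shows "a (s *s v) = s ^ (d - 1) *s a v"
proof -
  have "s * dot3 (a (s *s v)) w = s ^ d * dot3 (a v) w" for w
  proof -
    have "((\<lambda>t. F (s *s v + t *s (s *s w))) has_field_derivative dot3 (a (s *s v)) (s *s w)) (at 0)"
      using has_gradient_line[OF grad, of "s *s v" "s *s w" 0] by simp
    moreover have "F (s *s v + t *s (s *s w)) = s ^ d * F (v + t *s w)" for t
    proof -
      have "s *s v + t *s (s *s w) = s *s (v + t *s w)" by (simp add: vec_eq_iff algebra_simps)
      then show ?thesis by (simp only: hom)
    qed
    moreover have "((\<lambda>t. s ^ d * F (v + t *s w)) has_field_derivative s ^ d * dot3 (a v) w) (at 0)"
      using has_gradient_line[OF grad, of v w 0] by (intro DERIV_cmult) simp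
    ultimately show ?thesis by (simp add: DERIV_unique)
  qed
  moreover have "s ^ d = s * s ^ (d - 1)" using d by (cases d) auto
  ultimately have "dot3 (a (s *s v)) w = s ^ (d - 1) * dot3 (a v) w" for w
    using assms by (metis mult.assoc mult_left_cancel)
  from this[of "axis 1 1"] this[of "axis 2 1"] this[of "axis 3 1"] show ?thesis
    by (simp add: vec3_simps axis_def)
qed

lemma euler: "F v = 0 \<Longrightarrow> dot3 (a v) v = 0"
proof -
  assume v: "F v = 0"
  have "((\<lambda>t. F (0 + t *s v)) has_field_derivative dot3 (a (0 + 1 *s v)) v) (at 1)"
    by (rule has_gradient_line[OF grad])
  moreover have "F (0 + t *s v) = 0" for t using hom v by simp
  ultimately show ?thesis by (simp add: DERIV_unique[of "\<lambda>_. 0"])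
qed

definition \<gamma> :: "complex^3 \<Rightarrow> complex^3" where
  "\<gamma> v = cross (polar v) (a v)"

text \<open>The tangent plane of the cone at v is spanned by v and \<open>\<gamma> v\<close>. The
  logarithmic derivative of the determinant is 2 on v, by Euler's relation, and 0 on
  \<open>\<gamma> v\<close>, which lies on the polar line; S must take the same values.\<close>

definition crit :: "complex^3 \<Rightarrow> complex^3 \<Rightarrow> bool" where
  "crit S v \<longleftrightarrow> F v = 0 \<and> a v \<noteq> 0 \<and> det_form v \<noteq> 0 \<and> dot3 S v = 2 \<and> dot3 S (\<gamma> v) = 0"

lemma polymap_\<gamma>: "polymap \<gamma>"
  unfolding \<gamma>_def[abs_def] by (intro polymap_rules polymap_polar polymap_a)

lemma \<gamma>_scale: "s \<noteq> 0 \<Longrightarrow> \<gamma> (s *s v) = s ^ d *s \<gamma> v"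
  using d by (cases d) (simp_all add: \<gamma>_def a_scale vec3_simps algebra_simps)

text \<open>The line joining v and \<open>\<gamma> v\<close> is the tangent line at v. In particular
  the two are independent at a regular point off the conic det = 0.\<close>

lemma cross_\<gamma>: "F v = 0 \<Longrightarrow> cross v (\<gamma> v) = (- 2 * det_form v) *s a v"
proof -
  have "cross v (cross (polar v) w) = dot3 w v *s polar v - (2 * det_form v) *s w" for w
    by (simp add: vec3_simps) algebra
  from this[of "a v"] show "F v = 0 \<Longrightarrow> ?thesis" by (simp add: euler \<gamma>_def vec_eq_iff)
qed

lemma dot_a_\<gamma>: "dot3 (a v) (\<gamma> v) = 0"
  by (simp add: \<gamma>_def dot3_def) algebra

lemma critI:
  assumes "F v = 0" "a v \<noteq> 0" "det_form v \<noteq> 0" "dot3 S (\<gamma> v) = 0" "dot3 S v \<noteq> 0"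
  shows "crit S ((2 / dot3 S v) *s v)"
proof -
  have "(2 / dot3 S v) \<noteq> 0" using assms by simp
  moreover have "det_form (s *s v) = s\<^sup>2 * det_form v" for s
    by (simp add: det_form_def power2_eq_square algebra_simps)
  ultimately show ?thesis
    using assms unfolding crit_def by (simp add: hom a_scale \<gamma>_scale)
qed

text \<open>A line meets the image of \<^term>\<open>\<gamma>\<close> in a single point only if that image is itself contained
  in a line: otherwise two general points of the image span a line for which the critical point is
  not unique.\<close>

lemma \<gamma>_in_line:
  assumes g: "polyfun g" "g S1 \<noteq> 0" and unique: "\<And>S. g S \<noteq> 0 \<Longrightarrow> \<exists>!v. crit S v"
  shows "\<exists>B. B \<noteq> 0 \<and> (\<forall>v. F v = 0 \<longrightarrow> dot3 B (\<gamma> v) = 0)"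
proof (rule ccontr)
  assume "\<not> ?thesis"
  then have NB: "\<And>B. B \<noteq> 0 \<Longrightarrow> \<not> vanishes (\<lambda>v. dot3 B (\<gamma> v))"
    unfolding vanishes_def by blast
  note pf = polyfun_intros polymap_\<gamma> polymap_a
  have nd: "\<not> vanishes det_form" using not_det unfolding vanishes_def by blast
  have pd: "polyfun det_form" using polyfun_det_form[OF polymap_id] by simp
  obtain Ks where Ks: "crit S1 Ks" using unique[OF g(2)] by blast
  define as where "as = a Ks"
  have as: "as \<noteq> 0" "dot3 as Ks = 0" "dot3 S1 Ks = 2" "F Ks = 0"
    using Ks euler unfolding crit_def as_def by auto
  have "cross (cross S1 as) Ks = 2 *s as"
  proof -
    have "cross (cross S1 as) Ks = dot3 S1 Ks *s as - dot3 as Ks *s S1"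
      by (simp add: vec3_simps algebra_simps)
    then show ?thesis using as by simp
  qed
  then have "cross S1 as \<noteq> 0" using as(1) by (auto simp: vec3_simps)
  \<comment> \<open>By \<open>dot_cross_pencil\<close> and \<open>cross_\<gamma>\<close>, a form of
    the pencil that kills \<open>\<gamma> v\<close> is nonzero at v as soon as
    \<open>dot3 R (a v)\<close> and \<open>det_form v\<close> are nonzero. This Q makes the former
    nonzero at Ks, hence not identically zero on the curve.\<close>
  then obtain Q where "dot3 Q (cross S1 as) \<noteq> 0" using dot3_nondegenerate by blast
  moreover define R where "R = cross S1 Q"
  moreover have "dot3 (cross S1 Q) as = - dot3 Q (cross S1 as)" by (simp add: dot3_def algebra_simps)
  ultimately have R: "dot3 R as \<noteq> 0" by simp
  then have "R \<noteq> 0" by auto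
  then have Q0: "Q \<noteq> 0" and PQ: "\<And>t. S1 + t *s Q \<noteq> 0"
  proof -
    show "Q \<noteq> 0" using \<open>R \<noteq> 0\<close> by (auto simp: R_def vec3_simps)
    show "S1 + t *s Q \<noteq> 0" for t
    proof
      assume "S1 + t *s Q = 0"
      then have "S1 = (- t) *s Q" by (simp add: vec_eq_iff eq_neg_iff_add_eq_0)
      then show False using \<open>R \<noteq> 0\<close> by (simp add: R_def vec3_simps)
    qed
  qed
  \<comment> \<open>The last factor prepares the second pencil: it will give
    \<open>dot3 as R2 \<noteq> 0\<close>.\<close>
  define \<epsilon> where "\<epsilon> v = det_form v * (dot3 R (a v) * dot3 as (\<gamma> v))" for v
  have "\<not> vanishes (\<lambda>v. dot3 R (a v))" using R as unfolding vanishes_def as_def by blast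
  then have nv: "\<not> vanishes \<epsilon>"
    unfolding \<epsilon>_def using nd NB[OF as(1)] by (simp add: vanishes_mult pf pd)
  have p\<epsilon>: "polyfun \<epsilon>" unfolding \<epsilon>_def by (intro pf pd)
  obtain K1 t1 where K1: "F K1 = 0" "\<epsilon> K1 \<noteq> 0" "dot3 Q (\<gamma> K1) \<noteq> 0"
      "dot3 (S1 + t1 *s Q) (\<gamma> K1) = 0" "g (S1 + t1 *s Q) \<noteq> 0"
    by (rule exists_pencil_member[OF g polymap_\<gamma> p\<epsilon> nv NB[OF Q0] NB[OF PQ]])
  define S2 where "S2 = S1 + t1 *s Q"
  have K1': "det_form K1 \<noteq> 0" "dot3 R (a K1) \<noteq> 0" "dot3 as (\<gamma> K1) \<noteq> 0" "a K1 \<noteq> 0"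
    using K1(2) unfolding \<epsilon>_def by auto
  have S2\<gamma>: "dot3 S2 (\<gamma> K1) = 0" using K1(4) by (simp add: S2_def)
  have S2K1: "dot3 S2 K1 \<noteq> 0"
    using dot_cross_pencil[of S1 t1 Q K1 "\<gamma> K1"] K1 K1' cross_\<gamma>[OF K1(1)]
    by (auto simp: S2_def R_def)
  define R2 where "R2 = cross S2 (a K1)"
  \<comment> \<open>R2 plays the role of R for the second pencil. It is a nonzero multiple of
    \<open>\<gamma> K1\<close>, so it does not kill the tangent line at Ks.\<close>
  have "(- 2 * det_form K1) *s R2 = cross S2 (cross K1 (\<gamma> K1))"
    unfolding cross_\<gamma>[OF K1(1)] R2_def by (simp add: vec3_simps algebra_simps)
  also have "\<dots> = dot3 S2 (\<gamma> K1) *s K1 - dot3 S2 K1 *s \<gamma> K1"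
    by (simp add: vec3_simps algebra_simps)
  finally have "(2 * det_form K1) *s R2 = dot3 S2 K1 *s \<gamma> K1"
    using S2\<gamma> by (simp add: vec_eq_iff)
  then have "2 * det_form K1 * dot3 as R2 = dot3 S2 K1 * dot3 as (\<gamma> K1)"
    by (metis dot3_scale_right)
  then have "dot3 as R2 \<noteq> 0" using S2K1 K1' by auto
  then have R2: "dot3 R2 (a Ks) \<noteq> 0" by (simp add: as_def dot3_def mult.commute)
  then have "\<not> vanishes (\<lambda>v. dot3 R2 (a v))" using as unfolding vanishes_def by blast
  define \<epsilon>2 where "\<epsilon>2 v = det_form v * dot3 R2 (a v)" for v
  have nv2: "\<not> vanishes \<epsilon>2"
    unfolding \<epsilon>2_def using nd \<open>\<not> vanishes (\<lambda>v. dot3 R2 (a v))\<close> by (simp add: vanishes_mult pf pd)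
  have p\<epsilon>2: "polyfun \<epsilon>2" unfolding \<epsilon>2_def by (intro pf pd)
  have PQ2: "S2 + t *s a K1 \<noteq> 0" for t
  proof
    assume "S2 + t *s a K1 = 0"
    then have "dot3 (S2 + t *s a K1) K1 = 0" by simp
    then show False using S2K1 euler[OF K1(1)] by simp
  qed
  \<comment> \<open>All members of this pencil kill \<open>\<gamma> K1\<close>, since
    \<open>a K1\<close> does. So t can be spent on killing \<open>\<gamma> K2\<close> while K1 stays
    critical up to scale.\<close>
  obtain K2 t2 where K2: "F K2 = 0" "\<epsilon>2 K2 \<noteq> 0" "dot3 (a K1) (\<gamma> K2) \<noteq> 0"
      "dot3 (S2 + t2 *s a K1) (\<gamma> K2) = 0" "g (S2 + t2 *s a K1) \<noteq> 0"
    by (rule exists_pencil_member[OF g(1) K1(5)[folded S2_def] polymap_\<gamma> p\<epsilon>2 nv2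
          NB[OF K1'(4)] NB[OF PQ2]])
  define S3 where "S3 = S2 + t2 *s a K1"
  have K2': "det_form K2 \<noteq> 0" "dot3 R2 (a K2) \<noteq> 0" "a K2 \<noteq> 0"
    using K2(2) unfolding \<epsilon>2_def by auto
  have S3K2: "dot3 S3 K2 \<noteq> 0"
    using dot_cross_pencil[of S2 t2 "a K1" K2 "\<gamma> K2"] K2 K2' cross_\<gamma>[OF K2(1)]
    by (auto simp: S3_def R2_def)
  have S3K1: "dot3 S3 K1 \<noteq> 0" using S2K1 euler[OF K1(1)] by (simp add: S3_def)
  have S3\<gamma>: "dot3 S3 (\<gamma> K1) = 0" using S2\<gamma> dot_a_\<gamma> by (simp add: S3_def)
  have "crit S3 ((2 / dot3 S3 K1) *s K1)" by (rule critI) (use K1 K1' S3\<gamma> S3K1 in auto)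
  moreover have "crit S3 ((2 / dot3 S3 K2) *s K2)"
    by (rule critI) (use K2 K2' S3K2 in \<open>auto simp: S3_def\<close>)
  ultimately have eq: "(2 / dot3 S3 K1) *s K1 = (2 / dot3 S3 K2) *s K2"
    using unique K2(5) unfolding S3_def by blast
  \<comment> \<open>The two critical points differ because \<open>a K1\<close> kills
    \<open>\<gamma> K1\<close> but not \<open>\<gamma> K2\<close>.\<close>
  have "(2 / dot3 S3 K1) ^ d *s \<gamma> K1 = (2 / dot3 S3 K2) ^ d *s \<gamma> K2"
    using \<gamma>_scale[of "2 / dot3 S3 K1" K1] \<gamma>_scale[of "2 / dot3 S3 K2" K2] eq S3K1 S3K2 by simp
  then have "dot3 (a K1) ((2 / dot3 S3 K1) ^ d *s \<gamma> K1) = dot3 (a K1) ((2 / dot3 S3 K2) ^ d *s \<gamma> K2)"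
    by simp
  then show False using K2(3) S3K2 by (simp add: dot_a_\<gamma>)
qed

end

section \<open>The pencil of conics\<close>

text \<open>The linear vector field \<open>conic_field B\<close> is tangent to the conics of the pencil spanned by the
  determinant and the square of the linear form \<^term>\<open>dot3 B\<close>. In terms of matrices it is
  \<open>K \<mapsto> N K + K N\<^sup>T\<close> for a traceless matrix N with \<open>N\<^sup>2 = disc B\<close>, and \<open>twist B\<close> is
  \<open>K \<mapsto> N K N\<^sup>T\<close>; hence the shape of the flow below.\<close>

definition conic_field :: "complex^3 \<Rightarrow> complex^3 \<Rightarrow> complex^3" where
  "conic_field B v = cross (polar v) B"

text \<open>A quarter of the discriminant of B on the conic det = 0, parametrised by (x^2, x y,
  y^2). It is zero iff the line B = 0 is tangent to that conic or B = 0.\<close>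

definition disc :: "complex^3 \<Rightarrow> complex" where
  "disc B = (B$2)\<^sup>2 / 4 - B$1 * B$3"

definition twist :: "complex^3 \<Rightarrow> complex^3 \<Rightarrow> complex^3" where
  "twist B v = (1 / 2) *s conic_field B (conic_field B v) - disc B *s v"

lemma disc_half: "B$2 = 2 * b \<Longrightarrow> disc B = b * b - B$1 * B$3"
  by (simp add: disc_def power2_eq_square)

lemma twist_nth_half:
  assumes "B$2 = 2 * b"
  shows "twist B v $ 1 = b * b * v$1 + 2 * b * B$3 * v$2 + B$3 * B$3 * v$3"
    and "twist B v $ 2 = - (B$1 * b * v$1) - (b * b + B$1 * B$3) * v$2 - b * B$3 * v$3"
    and "twist B v $ 3 = B$1 * B$1 * v$1 + 2 * B$1 * b * v$2 + b * b * v$3"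
  using assms by (simp_all add: twist_def conic_field_def disc_half[OF assms] algebra_simps)

lemma half_middle: "\<exists>b. B $ 2 = 2 * b" for B :: "complex^3"
  by (intro exI[of _ "B $ 2 / 2"]) simp

lemma field_field: "conic_field B (conic_field B v) = (2 * disc B) *s v + 2 *s twist B v"
  by (simp add: twist_def vec_eq_iff algebra_simps)

text \<open>In terms of N, the first three follow from N^2 = disc B and det N = - disc B, and the
  last from N^T B N = - (disc B) B, with B read as a symmetric matrix. The opposite signs on the
  field and on the form B will contradict uniqueness.\<close>

lemma field_twist: "conic_field B (twist B v) = disc B *s conic_field B v"
  and twist_twist: "twist B (twist B v) = (disc B)\<^sup>2 *s v"
  and det_form_twist: "det_form (twist B v) = (disc B)\<^sup>2 * det_form v"
  and dot_twist: "dot3 B (twist B v) = - disc B * dot3 B v"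
proof -
  obtain b where b: "B $ 2 = 2 * b" using half_middle by blast
  note simps = vec3_simps twist_nth_half[OF b] disc_half[OF b] power2_eq_square b
  show "conic_field B (twist B v) = disc B *s conic_field B v"
    by (simp add: simps conic_field_def algebra_simps)
  show "twist B (twist B v) = (disc B)\<^sup>2 *s v"
    by (simp add: simps algebra_simps)
  show "det_form (twist B v) = (disc B)\<^sup>2 * det_form v"
    by (simp add: simps algebra_simps)
  show "dot3 B (twist B v) = - disc B * dot3 B v"
    by (simp add: simps algebra_simps)
qed

lemma field_add: "conic_field B (u + v) = conic_field B u + conic_field B v"
  and field_scale: "conic_field B (s *s v) = s *s conic_field B v"
  by (simp_all add: conic_field_def vec3_simps algebra_simps)

lemma polymap_field: "polymap G \<Longrightarrow> polymap (\<lambda>v. conic_field B (G v))"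
  unfolding conic_field_def by (intro polyfun_intros)

lemma polymap_twist: "polymap G \<Longrightarrow> polymap (\<lambda>v. twist B (G v))"
  unfolding twist_def by (intro polyfun_intros polymap_field)

text \<open>A triple product, in which \<open>polar v\<close> kills the field because the field
  preserves the determinant. It shows that v and its field vector are independent if det and the
  field are nonzero at v.\<close>

lemma cross_field: "cross (polar v) (cross v (conic_field B v)) = (- 2 * det_form v) *s conic_field B v"
  by (simp add: conic_field_def vec3_simps) algebra

lemma cross_commute: "cross u v = - cross v u"
  by (simp add: vec3_simps)

lemma polar_eq_0_iff: "polar u = 0 \<longleftrightarrow> u = 0"
  by (auto simp: vec3_simps)

lemma dot_field: "dot3 w (conic_field B v) = dot3 (polar (cross B w)) v"
  by (simp add: conic_field_def dot3_def algebra_simps)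

text \<open>Two nonempty Zariski open sets meet.\<close>

lemma exists_nonzero_mult:
  assumes "polyfun \<phi>" "polyfun \<psi>" "\<phi> x \<noteq> 0" "\<psi> y \<noteq> 0"
  shows "\<exists>v. \<phi> v \<noteq> 0 \<and> \<psi> v \<noteq> 0"
  using polyfun_mult_eq_0[OF assms(1,2) _ assms(4), of x] assms(3) by auto

section \<open>Curves tangent to a pencil of conics\<close>

context curve_cone
begin

lemma linear_not_vanishing: "B \<noteq> 0 \<Longrightarrow> \<not> vanishes (dot3 B)"
proof
  assume B: "B \<noteq> 0" and v: "vanishes (dot3 B)"
  have "dot3 B v = 0" for v
    by (rule vanishes_low_degree[where e = 1])
      (use d v polyfun_dot3[OF polymap_const polymap_id] in auto)
  then show False using dot3_nondegenerate[OF B] by (simp add: dot3_def mult.commute)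
qed

context
  fixes B :: "complex^3"
  assumes B: "B \<noteq> 0" and tangent: "\<And>v. F v = 0 \<Longrightarrow> dot3 B (\<gamma> v) = 0"
begin

text \<open>Since N^2 = disc B, the exponential of t N is C + S N, and the curve is its expanded
  action on K. C and S stay abstract to cover the hyperbolic functions and, for disc B = 0, the
  functions 1 and t.\<close>

lemma flow:
  assumes v: "F v = 0"
    and C: "\<And>t. (C has_field_derivative disc B * S t) (at t)" "C 0 = 1"
    and S: "\<And>t. (S has_field_derivative C t) (at t)" "S 0 = 0"
  shows "F ((C t)\<^sup>2 *s v + (C t * S t) *s conic_field B v + (S t)\<^sup>2 *s twist B v) = 0"
proof -
  define k where "k t = (C t)\<^sup>2 *s v + (C t * S t) *s conic_field B v + (S t)\<^sup>2 *s twist B v" for t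
  have k': "((\<lambda>t. k t $ i) has_field_derivative conic_field B (k t) $ i) (at t)" for t i
  proof -
    have "((\<lambda>t. k t $ i) has_field_derivative
        2 * C t * (disc B * S t) * v $ i
        + (disc B * (S t)\<^sup>2 + (C t)\<^sup>2) * conic_field B v $ i
        + 2 * S t * C t * twist B v $ i) (at t)"
      unfolding k_def
      by (rule derivative_eq_intros C S refl | simp)+ (simp add: power2_eq_square algebra_simps)
    moreover have "conic_field B (k t) = (2 * C t * (disc B * S t)) *s v
        + (disc B * (S t)\<^sup>2 + (C t)\<^sup>2) *s conic_field B v + (2 * S t * C t) *s twist B v"
      unfolding k_def
      by (simp add: field_add field_scale field_field field_twist)
        (simp add: vec_eq_iff algebra_simps)
    ultimately show ?thesis by (simp add: algebra_simps)
  qed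
  \<comment> \<open>Tangency is known on the curve only; divisibility by F turns it into a linear
    differential equation for F along k.\<close>
  have "\<exists>m. polyfun m \<and> (\<forall>v. dot3 (a v) (conic_field B v) = F v * m v)"
  proof (rule divides)
    show "polyfun (\<lambda>v. dot3 (a v) (conic_field B v))"
      by (intro polyfun_intros polymap_a polymap_field)
    fix v assume "F v = 0"
    moreover have "dot3 (a v) (conic_field B v) = - dot3 B (\<gamma> v)"
      by (simp add: conic_field_def \<gamma>_def dot3_def) algebra
    ultimately show "dot3 (a v) (conic_field B v) = 0" using tangent by simp
  qed
  then obtain m where m: "polyfun m" "\<And>v. dot3 (a v) (conic_field B v) = F v * m v" by blast
  have "(\<lambda>t. m (k t)) holomorphic_on UNIV"
    by (rule polyfun_holomorphic[OF m(1)])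
      (use k' in \<open>auto simp: holomorphic_on_def field_differentiable_def\<close>)
  then obtain g where g: "\<And>t. (g has_field_derivative m (k t)) (at t)"
    using holomorphic_convex_primitive'[of UNIV "\<lambda>t. m (k t)"] by auto
  \<comment> \<open>The integrating factor: F along k solves y' = (m o k) y with y(0) = 0, so it
    vanishes throughout.\<close>
  have "((\<lambda>t. F (k t) * exp (- g t)) has_field_derivative 0) (at t)" for t
  proof -
    have "((\<lambda>t. F (k t)) has_field_derivative F (k t) * m (k t)) (at t)"
      using has_gradientD[OF grad k'] m(2) by simp
    from DERIV_mult[OF this DERIV_chain2[OF DERIV_exp DERIV_minus[OF g]]] show ?thesis
      by (simp add: algebra_simps)
  qed
  then obtain c where "\<And>t. F (k t) * exp (- g t) = c"
    using has_field_derivative_zero_constant[of UNIV "\<lambda>t. F (k t) * exp (- g t)"] by auto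
  moreover have "F (k 0) = 0" using C S v by (simp add: k_def)
  ultimately have "F (k t) * exp (- g t) = 0" by (metis mult_zero_left)
  then show ?thesis by (simp add: k_def)
qed

lemma F_twist:
  assumes v: "F v = 0" and disc: "disc B \<noteq> 0"
  shows "F (twist B v) = 0"
proof -
  define r where "r = csqrt (disc B)"
  have r: "r \<noteq> 0" "r * r = disc B" using disc by (auto simp: r_def simp flip: power2_eq_square)
  define C where "C t = (exp (r * t) + exp (- (r * t))) / 2" for t
  define S where "S t = (exp (r * t) - exp (- (r * t))) / (2 * r)" for t
  \<comment> \<open>With r T = i pi / 2 the hyperbolic cosine vanishes and only the
    \<open>twist\<close> term of the flow survives, with a nonzero coefficient.\<close>
  define T where "T = \<i> * of_real pi / 2 / r"
  have e: "exp (r * T) = \<i>" "exp (- (r * T)) = - \<i>"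
  proof -
    have "r * T = \<i> * of_real (pi / 2)" using r by (simp add: T_def)
    then have "exp (r * T) = cis (pi / 2)" by (simp only: cis_conv_exp)
    then show "exp (r * T) = \<i>" by simp
    then show "exp (- (r * T)) = - \<i>" by (simp add: exp_minus)
  qed
  have "F ((C T)\<^sup>2 *s v + (C T * S T) *s conic_field B v + (S T)\<^sup>2 *s twist B v) = 0"
  proof (rule flow[OF v, where C = C and S = S])
    show "(C has_field_derivative disc B * S t) (at t)" for t
      unfolding C_def S_def using r
      by (auto intro!: derivative_eq_intros simp: field_simps simp flip: r(2))
    show "(S has_field_derivative C t) (at t)" for t
      unfolding C_def S_def using r by (auto intro!: derivative_eq_intros simp: field_simps)
  qed (simp_all add: C_def S_def)
  moreover have "C T = 0" "S T \<noteq> 0" using e r by (simp_all add: C_def S_def)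
  ultimately show ?thesis using hom by simp
qed

text \<open>Both vectors are killed by \<open>polar v\<close> and by B, and the field vector is the
  cross product of these two.\<close>

lemma \<gamma>_proportional:
  assumes "F v = 0" "conic_field B v \<noteq> 0" shows "\<exists>s. \<gamma> v = s *s conic_field B v"
proof -
  have "cross (\<gamma> v) (conic_field B v) = dot3 B (\<gamma> v) *s polar v - dot3 (polar v) (\<gamma> v) *s B"
    by (simp add: conic_field_def vec3_simps) algebra
  moreover have "dot3 (polar v) (\<gamma> v) = 0" by (simp add: \<gamma>_def dot3_def) algebra
  ultimately have "cross (\<gamma> v) (conic_field B v) = 0" using tangent[OF assms(1)] by (simp add: vec_eq_iff)
  then show ?thesis using cross_eq_0D assms(2) by blast
qed

lemma field_not_vanishing:
  assumes "cross B w \<noteq> 0" shows "\<not> vanishes (\<lambda>v. dot3 w (conic_field B v))"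
  using linear_not_vanishing[of "polar (cross B w)"] assms unfolding dot_field polar_eq_0_iff
  by (simp add: fun_eq_iff)

text \<open>If the pencil has two base points, then \<^term>\<open>twist B\<close> is an involution of the projective
  curve that permutes the critical points.\<close>

lemma disc_eq_0:
  assumes g: "polyfun g" "g S1 \<noteq> 0" and unique: "\<And>S. g S \<noteq> 0 \<Longrightarrow> \<exists>!v. crit S v"
  shows "disc B = 0"
proof (rule ccontr)
  assume disc: "disc B \<noteq> 0"
  note pf = polyfun_intros polymap_\<gamma> polymap_a polymap_field polymap_twist
  have nd: "\<not> vanishes det_form" using not_det unfolding vanishes_def by blast
  have pd: "polyfun det_form" using polyfun_det_form[OF polymap_id] by simp
  have "\<exists>w. cross B w \<noteq> 0"
  proof -
    obtain i where "B $ i \<noteq> 0" using B by (auto simp: vec_eq_iff)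
    then have "cross B (axis 1 1) \<noteq> 0 \<or> cross B (axis 2 1) \<noteq> 0"
      using exhaust_3[of i] by (auto simp: vec3_simps axis_def)
    then show ?thesis by blast
  qed
  then obtain w where w: "cross B w \<noteq> 0" by blast
  have "\<not> vanishes (\<lambda>v. det_form v * dot3 w (conic_field B v))"
    using nd field_not_vanishing[OF w] by (simp add: vanishes_mult pf pd)
  then obtain K0 where K0: "F K0 = 0" "det_form K0 \<noteq> 0" "dot3 w (conic_field B K0) \<noteq> 0"
    unfolding vanishes_def by auto
  then have fK0: "conic_field B K0 \<noteq> 0" by auto
  define R0 where "R0 = cross K0 (conic_field B K0)"
  have "cross (polar K0) R0 \<noteq> 0" using K0 fK0 unfolding R0_def cross_field by (simp add: vec_eq_iff)
  then have R0: "R0 \<noteq> 0" by (auto simp: vec3_simps)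
  have off: "\<exists>x u. dot3 u (cross x b) \<noteq> 0" if b: "b \<noteq> 0" for b :: "complex^3"
  proof -
    obtain i where "b $ i \<noteq> 0" using b by (auto simp: vec_eq_iff)
    then have "cross (axis 1 1) b \<noteq> 0 \<or> cross (axis 2 1) b \<noteq> 0"
      using exhaust_3[of i] by (auto simp: vec3_simps axis_def)
    then show ?thesis using dot3_nondegenerate by blast
  qed
  have pcr: "polyfun (\<lambda>x. dot3 u (cross x b))" and pdot: "polyfun (\<lambda>x. dot3 x b)" for u b
    by (intro pf)+
  obtain x1 u1 where u1: "dot3 u1 (cross x1 B) \<noteq> 0" using off[OF B] by blast
  obtain x2 u2 where u2: "dot3 u2 (cross x2 R0) \<noteq> 0" using off[OF R0] by blast
  obtain x3 where x3: "dot3 u1 (cross x3 B) \<noteq> 0" "dot3 u2 (cross x3 R0) \<noteq> 0"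
    using exists_nonzero_mult[OF pcr pcr u1 u2] by blast
  \<comment> \<open>P and Q are put in general position: B, P, Q independent means that no member of
    the pencil is a multiple of B, and R0, P, Q independent means that W is nonzero at K0.\<close>
  obtain P where P: "g P \<noteq> 0" "dot3 u1 (cross P B) * dot3 u2 (cross P R0) \<noteq> 0"
    using exists_nonzero_mult[OF g(1) polyfun_mult[OF pcr pcr] g(2), of u1 x3 B u2 R0] x3 by auto
  then have "cross P B \<noteq> 0" "cross P R0 \<noteq> 0" by auto
  then have "cross B P \<noteq> 0" "cross R0 P \<noteq> 0" by (simp_all add: cross_commute[of P])
  then obtain y1 y2 where "dot3 y1 (cross B P) \<noteq> 0" "dot3 y2 (cross R0 P) \<noteq> 0"
    using dot3_nondegenerate by metis
  then obtain Q where Q: "dot3 Q (cross B P) \<noteq> 0" "dot3 Q (cross R0 P) \<noteq> 0"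
    using exists_nonzero_mult[OF pdot pdot] by blast
  \<comment> \<open>By \<open>dot_cross_pencil\<close>, \<open>W v \<noteq> 0\<close> ensures that a
    form of the pencil killing the field at v is nonzero at v.\<close>
  define W where "W v = dot3 (cross P Q) (cross v (conic_field B v))" for v
  have W_scale: "W (s *s v) = s\<^sup>2 * W v" for s v
    by (simp add: W_def dot3_def conic_field_def algebra_simps power2_eq_square)
  have pW: "polyfun W" unfolding W_def by (intro pf)
  have "W K0 = dot3 Q (cross R0 P)" by (simp add: W_def R0_def[symmetric] dot3_def algebra_simps)
  then have W: "\<not> vanishes W" using Q K0 unfolding vanishes_def by auto
  obtain Ks where "crit S1 Ks" using unique[OF g(2)] by blast
  then obtain u where u: "dot3 u (a Ks) \<noteq> 0" "F Ks = 0"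
    using dot3_nondegenerate unfolding crit_def by blast
  then have au: "\<not> vanishes (\<lambda>v. dot3 u (a v))" unfolding vanishes_def by blast
  have W\<tau>: "\<not> vanishes (\<lambda>v. W (twist B v))"
  proof
    assume *: "vanishes (\<lambda>v. W (twist B v))"
    have "W v = 0" if "F v = 0" for v
      using * F_twist[OF that disc] disc W_scale[of "(disc B)\<^sup>2" v] twist_twist
      unfolding vanishes_def by (metis mult_eq_0_iff power_not_zero)
    then show False using W unfolding vanishes_def by blast
  qed
  have au\<tau>: "\<not> vanishes (\<lambda>v. dot3 u (a (twist B v)))"
  proof
    assume *: "vanishes (\<lambda>v. dot3 u (a (twist B v)))"
    have "dot3 u (a v) = 0" if "F v = 0" for v
    proof -
      have "dot3 u (a ((disc B)\<^sup>2 *s v)) = 0"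
        using * F_twist[OF that disc] twist_twist unfolding vanishes_def by metis
      then show ?thesis using disc by (simp add: a_scale)
    qed
    then show False using au unfolding vanishes_def by blast
  qed
  \<comment> \<open>The factors at \<open>twist B v\<close> make the image point a regular point on
    which S does not vanish; S kills the field there automatically, by
    \<open>field_twist\<close>.\<close>
  define \<epsilon> where "\<epsilon> v = det_form v * (dot3 B v * (W v * (W (twist B v) *
      (dot3 u (a v) * dot3 u (a (twist B v))))))" for v
  have pW\<tau>: "polyfun (\<lambda>v. W (twist B v))"
    by (intro polyfun_compose[OF pW] pf)
  have pa\<tau>: "polymap (\<lambda>v. a (twist B v))"
    by (intro polymap_compose[OF polymap_a] pf)
  have p\<epsilon>: "polyfun \<epsilon>" unfolding \<epsilon>_def by (intro pf pd pW pW\<tau> pa\<tau>)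
  have nv: "\<not> vanishes \<epsilon>"
    unfolding \<epsilon>_def using nd linear_not_vanishing[OF B] W W\<tau> au au\<tau>
    by (simp add: vanishes_mult pf pd pW pW\<tau> pa\<tau> fun_eq_iff)
  have PQ: "\<not> vanishes (\<lambda>v. dot3 (P + t *s Q) (conic_field B v))" for t
  proof (rule field_not_vanishing)
    have "dot3 Q (cross B (P + t *s Q)) = dot3 Q (cross B P)"
      by (simp add: dot3_def algebra_simps)
    then show "cross B (P + t *s Q) \<noteq> 0" using Q by auto
  qed
  have "dot3 Q (cross B P) = - dot3 P (cross B Q)" by (simp add: dot3_def algebra_simps)
  then have "cross B Q \<noteq> 0" using Q(1) by auto
  then have Qn: "\<not> vanishes (\<lambda>v. dot3 Q (conic_field B v))" by (rule field_not_vanishing)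
  have pfield: "polymap (conic_field B)" using polymap_field[OF polymap_id] by simp
  obtain v t where v: "F v = 0" "\<epsilon> v \<noteq> 0" "dot3 Q (conic_field B v) \<noteq> 0"
      "dot3 (P + t *s Q) (conic_field B v) = 0" "g (P + t *s Q) \<noteq> 0"
    by (rule exists_pencil_member[OF g(1) P(1) pfield p\<epsilon> nv Qn PQ])
  define S where "S = P + t *s Q"
  define \<tau>v where "\<tau>v = twist B v"
  have v': "det_form v \<noteq> 0" "dot3 B v \<noteq> 0" "W v \<noteq> 0" "W \<tau>v \<noteq> 0" "a v \<noteq> 0" "a \<tau>v \<noteq> 0"
    using v(2) unfolding \<epsilon>_def \<tau>v_def by auto
  have fv: "conic_field B v \<noteq> 0" using v(3) by auto
  have f\<tau>: "conic_field B \<tau>v = disc B *s conic_field B v" by (simp add: \<tau>v_def field_twist)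
  have Sf: "dot3 S (conic_field B v) = 0" "dot3 S (conic_field B \<tau>v) = 0"
    using v(4) by (simp_all add: S_def f\<tau>)
  have Sv: "dot3 S v \<noteq> 0"
    using dot_cross_pencil[of P t Q v "conic_field B v"] v'(3) Sf unfolding W_def S_def by auto
  have S\<tau>: "dot3 S \<tau>v \<noteq> 0"
    using dot_cross_pencil[of P t Q \<tau>v "conic_field B \<tau>v"] v'(4) Sf unfolding W_def S_def by auto
  have Z\<tau>: "F \<tau>v = 0" unfolding \<tau>v_def by (rule F_twist[OF v(1) disc])
  have "dot3 S (\<gamma> v) = 0" using \<gamma>_proportional[OF v(1) fv] Sf by auto
  then have "crit S ((2 / dot3 S v) *s v)" by (intro critI v v' Sv)
  moreover have "det_form \<tau>v \<noteq> 0" using v' disc by (simp add: \<tau>v_def det_form_twist)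
  moreover have "conic_field B \<tau>v \<noteq> 0" using f\<tau> fv disc by (simp add: vec_eq_iff)
  then have "dot3 S (\<gamma> \<tau>v) = 0" using \<gamma>_proportional[OF Z\<tau>] Sf by auto
  then have "crit S ((2 / dot3 S \<tau>v) *s \<tau>v)" using \<open>det_form \<tau>v \<noteq> 0\<close> by (intro critI Z\<tau> v' S\<tau>)
  ultimately have eq: "(2 / dot3 S v) *s v = (2 / dot3 S \<tau>v) *s \<tau>v"
    using unique v(5) unfolding S_def by blast
  define x y where "x = 2 / dot3 S v" and "y = 2 / dot3 S \<tau>v"
  \<comment> \<open>Applying B to the equality of the two critical points gives x = - y disc B,
    applying the field gives x = y disc B.\<close>
  have "dot3 B (x *s v) = dot3 B (y *s \<tau>v)" using eq by (simp add: x_def y_def)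
  then have "x * dot3 B v = - (y * disc B) * dot3 B v" by (simp add: \<tau>v_def dot_twist)
  then have 1: "x = - (y * disc B)" using v'(2) mult_right_cancel by blast
  have "conic_field B (x *s v) = conic_field B (y *s \<tau>v)" using eq by (simp add: x_def y_def)
  then have "dot3 Q (x *s conic_field B v) = dot3 Q ((y * disc B) *s conic_field B v)"
    using fv by (simp add: field_scale f\<tau>)
  then have "x = y * disc B" using v(3) by simp
  then have "x = 0" using 1 by simp
  then show False using Sv by (simp add: x_def)
qed

text \<open>If the line B = 0 is tangent to the conics of the pencil, then flowing into the normal form
  \<open>\<ell> e + (q / \<ell>) w\<close> shows that \<open>q / \<ell>\<^sup>2\<close> takes only finitely many values on the curve.\<close>

lemma degenerate_pencil_conic:
  assumes disc: "disc B = 0"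
  shows "\<exists>p1 p2 t. (p1, p2) \<noteq> (0, 0) \<and>
    (\<forall>v. F v = 0 \<longleftrightarrow> det_form v = t * (p1\<^sup>2 * v$1 + 2 * p1 * p2 * v$2 + p2\<^sup>2 * v$3)\<^sup>2)"
proof -
  define p1 where "p1 = csqrt (B$1)"
  \<comment> \<open>As disc B = 0, the binary quadratic form B is the square of (p1, p2); the sign
    of the root p2 is dictated by the middle coefficient.\<close>
  obtain p2 where p: "B$1 = p1 * p1" "B$2 = 2 * (p1 * p2)" "B$3 = p2 * p2"
  proof -
    have "(2 * (p1 * csqrt (B$3)))\<^sup>2 = (B$2)\<^sup>2"
      using disc by (simp add: p1_def disc_def power_mult_distrib)
    then have "B$2 = 2 * (p1 * csqrt (B$3)) \<or> B$2 = 2 * (p1 * - csqrt (B$3))"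
      unfolding power2_eq_iff by auto
    moreover have "B$1 = p1 * p1" by (simp add: p1_def flip: power2_eq_square)
    moreover have "B$3 = csqrt (B$3) * csqrt (B$3)" by (simp flip: power2_eq_square)
    ultimately show ?thesis using that by (metis minus_mult_minus)
  qed
  have p0: "(p1, p2) \<noteq> (0, 0)" using B p by (auto simp: vec3_simps)
  obtain u1 u2 where u: "p1 * u1 + p2 * u2 = 1"
  proof (cases "p1 = 0")
    case True
    then show ?thesis using that[of 0 "1 / p2"] p0 by simp
  next
    case False
    then show ?thesis using that[of "1 / p1" 0] by simp
  qed
  \<comment> \<open>With q = (-p2, p1), these are u u^T, u q^T + q u^T and q q^T. They form a Jordan
    chain of the nilpotent field, and w is the point where the line B = 0 touches the conic.\<close>
  define e m w :: "complex^3" where "e = vector [u1 * u1, u1 * u2, u2 * u2]"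
    and "m = vector [- 2 * u1 * p2, u1 * p1 - u2 * p2, 2 * u2 * p1]"
    and "w = vector [p2 * p2, - p1 * p2, p1 * p1]"
  note emw = e_def m_def w_def
  define \<beta> where "\<beta> v = - p1 * u2 * v$1 + (p1 * u1 - p2 * u2) * v$2 + p2 * u1 * v$3" for v :: "complex^3"
  define \<delta> where "\<delta> v = u2 * u2 * v$1 - 2 * u1 * u2 * v$2 + u1 * u1 * v$3" for v :: "complex^3"
  have decomp: "v = dot3 B v *s e + \<beta> v *s m + \<delta> v *s w" for v
    unfolding vec3_simps emw \<beta>_def \<delta>_def p using u by simp algebra
  have fe: "conic_field B e = m" and fm: "conic_field B m = 2 *s w" and fw: "conic_field B w = 0"
    unfolding conic_field_def vec3_simps emw using u by (simp_all add: p) algebra+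
  have ce: "dot3 B e = 1" "dot3 B w = 0" "dot3 B m = 0" 
    unfolding dot3_def emw using u by (simp_all add: p) (algebra | simp add: algebra_simps)+
  have q: "det_form v = dot3 B v * \<delta> v - (\<beta> v)\<^sup>2" for v
    unfolding det_form_def dot3_def \<beta>_def \<delta>_def p using u by algebra
  have fl: "F (l *s e + (b + t * l) *s m + (c + 2 * b * t + t * t * l) *s w) = 0"
    if "F (l *s e + b *s m + c *s w) = 0" for l b c t
  proof -
    have f: "conic_field B (l *s e + b *s m + c *s w) = l *s m + (2 * b) *s w"
      by (simp add: field_add field_scale fe fm fw vec_eq_iff)
    have tw: "twist B (l *s e + b *s m + c *s w) = l *s w"
      unfolding twist_def f disc by (simp add: field_add field_scale fm fw vec_eq_iff)
    have "F (1\<^sup>2 *s (l *s e + b *s m + c *s w) + (1 * t) *s conic_field B (l *s e + b *s m + c *s w)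
        + t\<^sup>2 *s twist B (l *s e + b *s m + c *s w)) = 0"
      using flow[OF that, where C = "\<lambda>_. 1" and S = "\<lambda>t. t"] disc by simp
    then show ?thesis unfolding f tw
      by (simp add: vec_eq_iff algebra_simps power2_eq_square vector_add_ldistrib vector_sadd_rdistrib
          vector_smult_assoc)
  qed
  \<comment> \<open>Flow for time \<open>- \<beta> v / l\<close> to remove the m-coordinate. The
    flow preserves det and B, which leaves det / l as the coefficient of w.\<close>
  have normal: "F v = 0 \<longleftrightarrow> F (e + (det_form v / (dot3 B v)\<^sup>2) *s w) = 0" if l: "dot3 B v \<noteq> 0" for v
  proof -
    define l where "l = dot3 B v"
    have l0: "l \<noteq> 0" using l by (simp add: l_def)
    have "F v = 0 \<longleftrightarrow> F (l *s e + 0 *s m + (det_form v / l) *s w) = 0"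
    proof
      assume "F v = 0"
      then have "F (l *s e + \<beta> v *s m + \<delta> v *s w) = 0" using decomp[of v] by (simp add: l_def)
      moreover have "\<beta> v + - \<beta> v / l * l = 0"
          "\<delta> v + 2 * \<beta> v * (- \<beta> v / l) + - \<beta> v / l * (- \<beta> v / l) * l = det_form v / l"
        unfolding q[of v] using l0 by (simp_all add: l_def[symmetric] field_simps power2_eq_square)
      ultimately show "F (l *s e + 0 *s m + (det_form v / l) *s w) = 0"
        using fl[of l "\<beta> v" "\<delta> v" "- \<beta> v / l"] by simp
    next
      assume "F (l *s e + 0 *s m + (det_form v / l) *s w) = 0"
      moreover have "0 + \<beta> v / l * l = \<beta> v"
          "det_form v / l + 2 * 0 * (\<beta> v / l) + \<beta> v / l * (\<beta> v / l) * l = \<delta> v"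
        unfolding q[of v] using l0 by (simp_all add: l_def[symmetric] field_simps power2_eq_square)
      ultimately have "F (l *s e + \<beta> v *s m + \<delta> v *s w) = 0"
        using fl[of l 0 "det_form v / l" "\<beta> v / l"] by simp
      then show "F v = 0" using decomp[of v] by (simp add: l_def)
    qed
    also have "l *s e + 0 *s m + (det_form v / l) *s w = l *s (e + (det_form v / l\<^sup>2) *s w)"
      using l0 by (simp add: vec_eq_iff field_simps power2_eq_square)
    finally show ?thesis unfolding F_scale_iff[OF l0] by (simp only: l_def)
  qed
  obtain h where h: "\<And>t. poly h t = F (e + t *s w)" using polyfun_line[OF polyfun_F] by blast
  have pl: "polyfun (dot3 B)" using polyfun_dot3[OF polymap_const polymap_id] by simp
  have pd: "polyfun det_form" using polyfun_det_form[OF polymap_id] by simp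
  have "h \<noteq> 0"
  proof
    assume "h = 0"
    then have "F v * dot3 B v = 0" for v using normal[of v] h by (metis mult_eq_0_iff poly_0)
    then have "F v = 0" for v using polyfun_mult_eq_0[OF polyfun_F pl] ce(1) by (metis one_neq_zero)
    then show False using F_nonzero by blast
  qed
  have "vanishes (\<lambda>v. (dot3 B v)\<^sup>2) \<or> vanishes (\<lambda>v. 1) \<or>
      (\<exists>t. vanishes (\<lambda>v. det_form v - t * (dot3 B v)\<^sup>2))"
    by (rule vanishes_ratio[OF pd polyfun_power[OF pl] polyfun_const \<open>h \<noteq> 0\<close>]) (use normal h in auto)
  moreover have "\<not> vanishes (\<lambda>v. (dot3 B v)\<^sup>2)"
    using linear_not_vanishing[OF B] unfolding vanishes_def by simp
  moreover have "\<not> vanishes (\<lambda>v. 1)" using not_det unfolding vanishes_def by auto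
  ultimately obtain t where t: "vanishes (\<lambda>v. det_form v - t * (dot3 B v)\<^sup>2)" by blast
  define \<phi> where "\<phi> v = det_form v - t * (dot3 B v)\<^sup>2" for v
  have p\<phi>: "polyfun \<phi>" unfolding \<phi>_def by (intro polyfun_rules pd pl)
  have \<phi>_hom: "\<phi> (s *s v) = s\<^sup>2 * \<phi> v" for s v
    by (simp add: \<phi>_def det_form_def power2_eq_square algebra_simps)
  \<comment> \<open>B takes the value 1 at e and at e + w, but the determinants are 0 and 1, so no t
    makes \<open>\<phi>\<close> vanish at both.\<close>
  have \<phi>0: "\<exists>v. \<phi> v \<noteq> 0"
  proof (rule ccontr)
    assume *: "\<not> ?thesis"
    have 1: "det_form e = 0" by (simp add: det_form_def e_def)
    have 2: "det_form (e + w) = 1" using u unfolding det_form_def emw by simp algebra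
    have "\<phi> e = 0" "\<phi> (e + w) = 0" using * by auto
    then show False using 1 2 ce by (simp add: \<phi>_def)
  qed
  \<comment> \<open>A nonzero quadratic form vanishes on the curve, so d = 2 and the cofactor k is
    constant. This makes the two zero sets equal, where \<open>t\<close> only gave an
    inclusion.\<close>
  have "\<not> 2 < d"
    using vanishes_low_degree[OF p\<phi> \<phi>_hom _ t[folded \<phi>_def]] \<phi>0 by blast
  then have d2: "d = 2" using d by simp
  obtain k where k: "polyfun k" "\<And>v. \<phi> v = F v * k v"
    using divides[OF p\<phi>] t unfolding vanishes_def \<phi>_def by blast
  have k0: "\<phi> v = F v * k 0" for v
  proof -
    obtain h where h: "\<And>t. poly h t = k (0 + t *s v)" using polyfun_line[OF k(1)] by blast
    have "poly ([:\<phi> v:] - smult (F v) h) s = 0" if "s \<noteq> 0" for s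
      using k(2)[of "s *s v"] \<phi>_hom hom d2 that h[of s] by simp
    from poly_zero_off_0[OF this, of 0] show ?thesis using h[of 0] by simp
  qed
  then have "k 0 \<noteq> 0" using \<phi>0 by auto
  then have "F v = 0 \<longleftrightarrow> \<phi> v = 0" for v using k0 by simp
  moreover have "dot3 B v = p1\<^sup>2 * v$1 + 2 * p1 * p2 * v$2 + p2\<^sup>2 * v$3" for v
    by (simp add: dot3_def p power2_eq_square)
  ultimately show ?thesis using p0 unfolding \<phi>_def
    by (intro exI[of _ p1] exI[of _ p2] exI[of _ t]) simp
qed

end

theorem unique_critical_point_imp_conic:
  assumes g: "polyfun g" "g S1 \<noteq> 0" and unique: "\<And>S. g S \<noteq> 0 \<Longrightarrow> \<exists>!v. crit S v"
  shows "\<exists>p1 p2 t. (p1, p2) \<noteq> (0, 0) \<and>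
    (\<forall>v. F v = 0 \<longleftrightarrow> det_form v = t * (p1\<^sup>2 * v$1 + 2 * p1 * p2 * v$2 + p2\<^sup>2 * v$3)\<^sup>2)"
proof -
  obtain B where B: "B \<noteq> 0" "\<And>v. F v = 0 \<Longrightarrow> dot3 B (\<gamma> v) = 0"
    using \<gamma>_in_line[OF g unique] by blast
  show ?thesis by (rule degenerate_pencil_conic[OF B disc_eq_0[OF B g unique]])
qed

end

section \<open>Symmetric matrices in coordinates\<close>

definition coords :: "cmat \<Rightarrow> complex^3" where
  "coords K = vector [K $ 1 $ 1, K $ 1 $ 2, K $ 2 $ 2]"

definition sym_mat :: "complex^3 \<Rightarrow> cmat" where
  "sym_mat v = vector [vector [v $ 1, v $ 2], vector [v $ 2, v $ 3]]"

text \<open>The factor 2 turns the trace pairing of S and K into \<^term>\<open>dot3 (dual_coords S) (coords K)\<close>.\<close>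

definition dual_coords :: "cmat \<Rightarrow> complex^3" where
  "dual_coords S = vector [S $ 1 $ 1, 2 * S $ 1 $ 2, S $ 2 $ 2]"

lemma coords_nth [simp]: "coords K $ 1 = K $ 1 $ 1" "coords K $ 2 = K $ 1 $ 2" "coords K $ 3 = K $ 2 $ 2"
  by (simp_all add: coords_def)

lemma dual_coords_nth [simp]: "dual_coords K $ 1 = K $ 1 $ 1" "dual_coords K $ 2 = 2 * K $ 1 $ 2" "dual_coords K $ 3 = K $ 2 $ 2"
  by (simp_all add: dual_coords_def)

lemma sym_mat_nth [simp]: "sym_mat v $ 1 $ 1 = v $ 1" "sym_mat v $ 1 $ 2 = v $ 2" "sym_mat v $ 2 $ 1 = v $ 2" "sym_mat v $ 2 $ 2 = v $ 3"
  by (simp_all add: sym_mat_def)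

lemma Sym_iff: "K \<in> Sym \<longleftrightarrow> K $ 2 $ 1 = K $ 1 $ 2"
  by (auto simp: Sym_def transpose_def vec_eq_iff forall_2)

lemma cmul_nth [simp]: "(c *\<^sub>c K) $ i $ j = c * K $ i $ j"
  by (simp add: cmul_def)

lemma sym_mat_in_Sym [simp]: "sym_mat v \<in> Sym"
  and coords_sym_mat [simp]: "coords (sym_mat v) = v"
  and sym_mat_coords: "K \<in> Sym \<Longrightarrow> sym_mat (coords K) = K"
  by (auto simp: Sym_iff vec_eq_iff forall_2 forall_3)

lemma coords_add [simp]: "coords (K + L) = coords K + coords L"
  and coords_cmul [simp]: "coords (c *\<^sub>c K) = c *s coords K"
  and coords_0 [simp]: "coords 0 = 0"
  by (simp_all add: vec_eq_iff forall_3)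

lemma coords_eq_iff: "K \<in> Sym \<Longrightarrow> L \<in> Sym \<Longrightarrow> coords K = coords L \<longleftrightarrow> K = L"
  by (metis sym_mat_coords)

lemma Sym_cmul: "K \<in> Sym \<Longrightarrow> c *\<^sub>c K \<in> Sym"
  and Sym_add: "K \<in> Sym \<Longrightarrow> L \<in> Sym \<Longrightarrow> K + L \<in> Sym"
  and Sym_0: "0 \<in> Sym"
  by (simp_all add: Sym_iff)

lemma peval_ev3: "peval f K = ev3 f (coords K)"
  by (simp add: peval_def ev3_def)

lemma det_Sym: "K \<in> Sym \<Longrightarrow> det K = det_form (coords K)"
  by (simp add: det_2 det_form_def Sym_iff)

lemma trace_Sym: "S \<in> Sym \<Longrightarrow> K \<in> Sym \<Longrightarrow> trace (S ** K) = dot3 (dual_coords S) (coords K)"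
  by (simp add: trace_def matrix_matrix_mult_def sum_2 dot3_def Sym_iff)

section \<open>General symmetric matrices and fibres\<close>

lemma generically_iff:
  "generically P \<longleftrightarrow> (\<exists>g w. polyfun g \<and> g w \<noteq> 0 \<and> (\<forall>S\<in>Sym. g (coords S) \<noteq> 0 \<longrightarrow> P S))"
proof
  assume "generically P"
  then obtain g where g: "g \<noteq> 0" "\<forall>S\<in>Sym. peval g S \<noteq> 0 \<longrightarrow> P S" unfolding generically_def by blast
  obtain w where "ev3 g w \<noteq> 0" using ev3_nonzero[OF g(1)] by blast
  then show "\<exists>g w. polyfun g \<and> g w \<noteq> 0 \<and> (\<forall>S\<in>Sym. g (coords S) \<noteq> 0 \<longrightarrow> P S)"
    using g(2) polyfun_ev3 unfolding peval_ev3 by blast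
next
  assume "\<exists>g w. polyfun g \<and> g w \<noteq> 0 \<and> (\<forall>S\<in>Sym. g (coords S) \<noteq> 0 \<longrightarrow> P S)"
  then obtain g w where g: "polyfun g" "g w \<noteq> 0" "\<forall>S\<in>Sym. g (coords S) \<noteq> 0 \<longrightarrow> P S" by blast
  obtain f where f: "g = ev3 f" using polyfun_imp_ev3[OF g(1)] by blast
  moreover have "f \<noteq> 0" using f g(2) by (auto simp: ev3_def)
  ultimately show "generically P" using g(3) unfolding generically_def peval_ev3 by blast
qed

lemma generically_conj:
  assumes "generically P" "generically Q" shows "generically (\<lambda>S. P S \<and> Q S)"
proof -
  obtain g w where g: "polyfun g" "g w \<noteq> 0" "\<And>S. S \<in> Sym \<Longrightarrow> g (coords S) \<noteq> 0 \<Longrightarrow> P S"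
    using assms(1) unfolding generically_iff by blast
  obtain h x where h: "polyfun h" "h x \<noteq> 0" "\<And>S. S \<in> Sym \<Longrightarrow> h (coords S) \<noteq> 0 \<Longrightarrow> Q S"
    using assms(2) unfolding generically_iff by blast
  obtain y where "g y \<noteq> 0" "h y \<noteq> 0" using exists_nonzero_mult[OF g(1) h(1) g(2) h(2)] by blast
  then show ?thesis unfolding generically_iff
    using g(3) h(3) polyfun_mult[OF g(1) h(1)]
    by (intro exI[of _ "\<lambda>v. g v * h v"] exI[of _ y]) auto
qed

lemma generically_mono: "generically P \<Longrightarrow> (\<And>S. S \<in> Sym \<Longrightarrow> P S \<Longrightarrow> Q S) \<Longrightarrow> generically Q"
  unfolding generically_def by blast

lemma generically_imp_ex: "generically P \<Longrightarrow> \<exists>S\<in>Sym. P S"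
  unfolding generically_iff by (metis coords_sym_mat sym_mat_in_Sym)

lemma general_fibre_card_unique:
  assumes "general_fibre_card R m" "general_fibre_card R n" shows "m = n"
  using generically_imp_ex[OF generically_conj[OF assms[unfolded general_fibre_card_def]]] by auto

lemma proj_degree_eq: "general_fibre_card R n \<Longrightarrow> proj_degree R = n"
  unfolding proj_degree_def using general_fibre_card_unique by (auto intro!: the_equality)

lemma proj_degree_imp: "proj_degree R = n \<Longrightarrow> n \<noteq> 0 \<Longrightarrow> general_fibre_card R n"
  using proj_degree_eq[of R] unfolding proj_degree_def by metis

section \<open>Spans, cones and dimensions\<close>

lemma span_cmat_singleton: "K \<in> cmat.span {L} \<longleftrightarrow> (\<exists>c. K = c *\<^sub>c L)"
  by (simp add: cmat.span_breakdown_eq)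

lemma affine_cone_proj_zeros:
  assumes "\<And>c K. K \<in> Sym \<Longrightarrow> \<phi> K = 0 \<Longrightarrow> \<phi> (c *\<^sub>c K) = 0" and "\<phi> 0 = 0"
  shows "affine_cone (proj_zeros \<phi>) = {K \<in> Sym. \<phi> K = 0}"
proof (intro set_eqI iffI)
  fix K assume "K \<in> affine_cone (proj_zeros \<phi>)"
  then consider "K = 0" | x where "x \<in> proj_zeros \<phi>" "K \<in> x" by (auto simp: affine_cone_def)
  then show "K \<in> {K \<in> Sym. \<phi> K = 0}"
  proof cases
    case 2
    then obtain L where "L \<in> Sym" "K \<in> cmat.span {L}" "\<phi> K = 0"
      by (auto simp: proj_zeros_def proj_points_def)
    then show ?thesis using Sym_cmul by (auto simp: span_cmat_singleton)
  qed (use assms Sym_0 in auto)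
next
  fix K assume K: "K \<in> {K \<in> Sym. \<phi> K = 0}"
  show "K \<in> affine_cone (proj_zeros \<phi>)"
  proof (cases "K = 0")
    case False
    have "cmat.span {K} \<in> proj_zeros \<phi>"
      using K False assms(1) by (auto simp: proj_zeros_def proj_points_def span_cmat_singleton)
    moreover have "K \<in> cmat.span {K}" by (rule cmat.span_base) simp
    ultimately show ?thesis by (auto simp: affine_cone_def)
  qed (simp add: affine_cone_def)
qed

lemma proj_zeros_cong:
  assumes "\<And>K. K \<in> Sym \<Longrightarrow> \<phi> K = 0 \<longleftrightarrow> \<psi> K = 0" shows "proj_zeros \<phi> = proj_zeros \<psi>"
proof -
  have "K \<in> Sym" if "x \<in> proj_points" "K \<in> x" for x K
    using that Sym_cmul by (auto simp: proj_points_def span_cmat_singleton)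
  then show ?thesis using assms unfolding proj_zeros_def by blast
qed

lemma cmat_span_pair: "K \<in> cmat.span {L, M} \<longleftrightarrow> (\<exists>x y. K = x *\<^sub>c L + y *\<^sub>c M)"
  by (simp add: cmat.span_breakdown_eq) (metis add.commute diff_add_cancel diff_eq_eq)

lemma dim_span_pair:
  assumes "cross u v \<noteq> 0" shows "cmat.dim (cmat.span {sym_mat u, sym_mat v}) = 2"
proof -
  have ne: "sym_mat u \<notin> cmat.span {sym_mat v}"
  proof
    assume "sym_mat u \<in> cmat.span {sym_mat v}"
    then obtain c where "sym_mat u = c *\<^sub>c sym_mat v" by (auto simp: span_cmat_singleton)
    then have "coords (sym_mat u) = coords (c *\<^sub>c sym_mat v)" by simp
    then have "u = c *s v" by simp
    then show False using assms by (simp add: vec3_simps)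
  qed
  have "sym_mat v \<noteq> 0"
  proof
    assume "sym_mat v = 0"
    then have "coords (sym_mat v) = coords 0" by simp
    then show False using assms by (simp add: vec3_simps)
  qed
  then have "cmat.independent {sym_mat u, sym_mat v}" using ne
    by (intro cmat.independent_insertI cmat.independent_empty) simp_all
  moreover have "sym_mat u \<noteq> sym_mat v" using ne cmat.span_base by blast
  ultimately show ?thesis by (simp add: cmat.dim_eq_card_independent)
qed

lemma dim_Sym: "cmat.dim Sym = 3"
proof -
  define e :: "3 \<Rightarrow> cmat" where "e i = sym_mat (axis i 1)" for i
  have n1: "e 1 \<notin> cmat.span {e 2, e 3}" and n2: "e 2 \<notin> cmat.span {e 3}"
    by (auto simp: cmat_span_pair span_cmat_singleton e_def vec_eq_iff forall_2 axis_def)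
  moreover have "e 3 \<noteq> 0" by (auto simp: e_def vec_eq_iff forall_2 axis_def)
  ultimately have ind: "cmat.independent {e 1, e 2, e 3}"
    by (intro cmat.independent_insertI cmat.independent_empty) simp_all
  have neq: "e 1 \<noteq> e 2" "e 1 \<noteq> e 3" "e 2 \<noteq> e 3"
    by (auto simp: e_def vec_eq_iff forall_2 axis_def)
  have "Sym = cmat.span {e 1, e 2, e 3}"
  proof (intro set_eqI iffI)
    fix K assume K: "K \<in> Sym"
    have "K - K$1$1 *\<^sub>c e 1 = K$1$2 *\<^sub>c e 2 + K$2$2 *\<^sub>c e 3"
      using K by (simp add: e_def vec_eq_iff forall_2 axis_def Sym_iff)
    then show "K \<in> cmat.span {e 1, e 2, e 3}"
      using cmat.span_breakdown_eq cmat_span_pair by blast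
  next
    fix K assume "K \<in> cmat.span {e 1, e 2, e 3}"
    then show "K \<in> Sym"
      by (rule cmat.span_induct_alt) (auto simp: e_def intro!: Sym_add Sym_cmul Sym_0)
  qed
  then have "cmat.dim Sym = card {e 1, e 2, e 3}"
    using cmat.dim_span_eq_card_independent[OF ind] by (rule ssubst)
  also have "\<dots> = 3" using neq by simp
  finally show ?thesis .
qed

text \<open>With \<open>\<alpha>\<close> a gradient, this turns regularity of a point of the cone
  into nonvanishing of the gradient.\<close>

lemma dim_hyperplane: "cmat.dim {w \<in> Sym. dot3 \<alpha> (coords w) = 0} = 2 \<longleftrightarrow> \<alpha> \<noteq> 0"
proof (cases "\<alpha> = 0")
  case True
  then show ?thesis by (simp add: dim_Sym)
next
  case False
  then consider "\<alpha> $ 1 \<noteq> 0" | "\<alpha> $ 2 \<noteq> 0" | "\<alpha> $ 3 \<noteq> 0" by (auto simp: vec_eq_iff forall_3)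
  then obtain u v where uv: "cross u v \<noteq> 0" "dot3 \<alpha> u = 0" "dot3 \<alpha> v = 0"
    and sp: "\<And>w. dot3 \<alpha> w = 0 \<Longrightarrow> \<exists>x y. w = x *s u + y *s v"
  proof cases
    case 1
    show ?thesis
    proof (rule that[of "vector [- \<alpha>$2, \<alpha>$1, 0]" "vector [- \<alpha>$3, 0, \<alpha>$1]"])
      fix w :: "complex^3" assume "dot3 \<alpha> w = 0"
      then have "\<alpha>$1 * w$1 = - (\<alpha>$2 * w$2) - \<alpha>$3 * w$3" by (simp add: dot3_def) algebra
      then have "w = (w$2 / \<alpha>$1) *s vector [- \<alpha>$2, \<alpha>$1, 0] + (w$3 / \<alpha>$1) *s vector [- \<alpha>$3, 0, \<alpha>$1]"
        using 1 by (simp add: vec3_simps field_simps)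
      then show "\<exists>x y. w = x *s vector [- \<alpha>$2, \<alpha>$1, 0] + y *s vector [- \<alpha>$3, 0, \<alpha>$1]" by blast
    qed (use 1 in \<open>auto simp: vec3_simps\<close>)
  next
    case 2
    show ?thesis
    proof (rule that[of "vector [\<alpha>$2, - \<alpha>$1, 0]" "vector [0, - \<alpha>$3, \<alpha>$2]"])
      fix w :: "complex^3" assume "dot3 \<alpha> w = 0"
      then have "\<alpha>$2 * w$2 = - (\<alpha>$1 * w$1) - \<alpha>$3 * w$3" by (simp add: dot3_def) algebra
      then have "w = (w$1 / \<alpha>$2) *s vector [\<alpha>$2, - \<alpha>$1, 0] + (w$3 / \<alpha>$2) *s vector [0, - \<alpha>$3, \<alpha>$2]"
        using 2 by (simp add: vec3_simps field_simps)
      then show "\<exists>x y. w = x *s vector [\<alpha>$2, - \<alpha>$1, 0] + y *s vector [0, - \<alpha>$3, \<alpha>$2]" by blast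
    qed (use 2 in \<open>auto simp: vec3_simps\<close>)
  next
    case 3
    show ?thesis
    proof (rule that[of "vector [\<alpha>$3, 0, - \<alpha>$1]" "vector [0, \<alpha>$3, - \<alpha>$2]"])
      fix w :: "complex^3" assume "dot3 \<alpha> w = 0"
      then have "\<alpha>$3 * w$3 = - (\<alpha>$1 * w$1) - \<alpha>$2 * w$2" by (simp add: dot3_def) algebra
      then have "w = (w$1 / \<alpha>$3) *s vector [\<alpha>$3, 0, - \<alpha>$1] + (w$2 / \<alpha>$3) *s vector [0, \<alpha>$3, - \<alpha>$2]"
        using 3 by (simp add: vec3_simps field_simps)
      then show "\<exists>x y. w = x *s vector [\<alpha>$3, 0, - \<alpha>$1] + y *s vector [0, \<alpha>$3, - \<alpha>$2]" by blast
    qed (use 3 in \<open>auto simp: vec3_simps\<close>)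
  qed
  have "{w \<in> Sym. dot3 \<alpha> (coords w) = 0} = cmat.span {sym_mat u, sym_mat v}"
  proof (intro set_eqI iffI)
    fix w assume w: "w \<in> {w \<in> Sym. dot3 \<alpha> (coords w) = 0}"
    then obtain x y where "coords w = x *s u + y *s v" using sp by blast
    then have "coords w = coords (x *\<^sub>c sym_mat u + y *\<^sub>c sym_mat v)" by simp
    then have "w = x *\<^sub>c sym_mat u + y *\<^sub>c sym_mat v"
      using w coords_eq_iff[of w "x *\<^sub>c sym_mat u + y *\<^sub>c sym_mat v"] by (simp add: Sym_add Sym_cmul)
    then show "w \<in> cmat.span {sym_mat u, sym_mat v}" unfolding cmat_span_pair by blast
  next
    fix w assume "w \<in> cmat.span {sym_mat u, sym_mat v}"
    then show "w \<in> {w \<in> Sym. dot3 \<alpha> (coords w) = 0}"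
      unfolding cmat_span_pair using uv by (auto simp: Sym_add Sym_cmul)
  qed
  then show ?thesis using dim_span_pair[OF uv(1)] False by simp
qed

lemma rank_1_iff:
  fixes A :: cmat
  shows "rank A = 1 \<longleftrightarrow> A \<noteq> 0 \<and> det A = 0"
proof -
  define r1 r2 where "r1 = row 1 A" and "r2 = row 2 A"
  have rows: "rows A = {r1, r2}"
  proof -
    have "rows A = (\<lambda>i. row i A) ` UNIV" by (auto simp: rows_def)
    then show ?thesis by (simp add: UNIV_2 r1_def r2_def)
  qed
  have rk: "rank A = vec.dim {r1, r2}" by (simp add: row_rank_def_gen rows)
  have r: "r1 $ 1 = A$1$1" "r1 $ 2 = A$1$2" "r2 $ 1 = A$2$1" "r2 $ 2 = A$2$2"
    by (simp_all add: r1_def r2_def row_def)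
  have det: "det A = r1$1 * r2$2 - r1$2 * r2$1" by (simp add: det_2 r)
  have A0: "A = 0 \<longleftrightarrow> r1 = 0 \<and> r2 = 0" by (auto simp: vec_eq_iff forall_2 r)
  have sing: "x \<in> vec.span {y} \<longleftrightarrow> (\<exists>c. x = c *s y)" for x y :: "complex^2"
    by (simp add: vec.span_breakdown_eq)
  have one: "vec.dim {x, y} = 1" if "x \<noteq> 0" "y = c *s x" for x y :: "complex^2" and c
  proof (rule vec.dim_unique[of "{x}"])
    show "{x, y} \<subseteq> vec.span {x}" using that by (auto simp: sing intro: exI[of _ 1])
    show "vec.independent {x}"
      using that by (intro vec.independent_insertI vec.independent_empty) simp_all
  qed simp_all
  show ?thesis
  proof (cases "det A = 0")
    case True
    then have d: "r1$1 * r2$2 = r1$2 * r2$1" by (simp add: det)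
    consider "A = 0" | "r1 \<noteq> 0" | "r1 = 0" "r2 \<noteq> 0" using A0 by blast
    then show ?thesis
    proof cases
      case 1
      then have "vec.dim {r1, r2} \<le> card ({} :: (complex^2) set)"
        using A0 by (intro vec.dim_le_card) auto
      then show ?thesis using 1 rk by simp
    next
      case 2
      then obtain c where "r2 = c *s r1"
      proof (cases "r1 $ 1 = 0")
        case True
        then have "r1 $ 2 \<noteq> 0" using 2 by (auto simp: vec_eq_iff forall_2)
        then have "r2 = (r2$2 / r1$2) *s r1"
          using d True by (auto simp: vec_eq_iff forall_2)
        then show ?thesis by (rule that)
      next
        case False
        then have "r2 = (r2$1 / r1$1) *s r1"
          using d by (auto simp: vec_eq_iff forall_2 field_simps)
        then show ?thesis by (rule that)
      qed
      then show ?thesis using one[OF 2] rk A0 2 True by simp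
    next
      case 3
      then have "vec.dim {r2, r1} = 1" using one[of r2 r1 0] by simp
      then show ?thesis using rk A0 3 True by (simp add: insert_commute)
    qed
  next
    case False
    have n: "r1 \<notin> vec.span {r2}" and "r2 \<noteq> 0" using False by (auto simp: det sing)
    then have "vec.independent {r1, r2}"
      by (intro vec.independent_insertI vec.independent_empty) simp_all
    moreover have "r1 \<noteq> r2" using n vec.span_base by blast
    ultimately show ?thesis using False rk by (simp add: vec.dim_eq_card_independent)
  qed
qed

section \<open>Homogeneity and derivatives in coordinates\<close>

lemma ev3_expand:
  "ev3 f v = (\<Sum>i\<le>degree f. \<Sum>j\<le>degree (coeff f i). \<Sum>k\<le>degree (coeff (coeff f i) j).
     coeff (coeff (coeff f i) j) k * v$3 ^ k * v$2 ^ j * v$1 ^ i)"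
proof -
  have 1: "poly (poly p [:y:]) z = (\<Sum>j\<le>degree p. poly (coeff p j) z * y ^ j)" for p :: "complex poly poly" and y z
    by (subst poly_altdef[of p]) (simp add: poly_sum)
  have 2: "poly (poly (poly f [:[:x:]:]) [:y:]) z = (\<Sum>i\<le>degree f. poly (poly (coeff f i) [:y:]) z * x ^ i)" for x y z
    by (subst poly_altdef[of f]) (simp add: poly_sum)
  have 3: "poly p z = (\<Sum>k\<le>degree p. coeff p k * z ^ k)" for p :: "complex poly" and z
    by (rule poly_altdef)
  have "ev3 f v = (\<Sum>i\<le>degree f. (\<Sum>j\<le>degree (coeff f i).
      poly (coeff (coeff f i) j) (v$3) * v$2 ^ j) * v$1 ^ i)"
    unfolding ev3_def 2 by (simp only: 1)
  then show ?thesis by (simp add: 3 sum_distrib_right)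
qed

lemma homogeneous_scale:
  assumes "homogeneous d f" shows "ev3 f (s *s v) = s ^ d * ev3 f v"
proof -
  have "coeff (coeff (coeff f i) j) k * (s * v$3) ^ k * (s * v$2) ^ j * (s * v$1) ^ i =
      s ^ d * (coeff (coeff (coeff f i) j) k * v$3 ^ k * v$2 ^ j * v$1 ^ i)" for i j k
  proof (cases "coeff (coeff (coeff f i) j) k = 0")
    case False
    then have "d = k + j + i" using assms unfolding homogeneous_def by force
    then show ?thesis by (simp add: power_mult_distrib power_add)
  qed simp
  then show ?thesis unfolding ev3_expand sum_distrib_left vector_smult_component
    by (intro sum.cong refl)
qed

lemma differential_peval:
  assumes "has_gradient (ev3 f) G"
  shows "differential (peval f) K w = dot3 (G (coords K)) (coords w)"
  using has_gradient_line[OF assms, of "coords K" "coords w" 0]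
  by (simp add: differential_def peval_ev3 DERIV_imp_deriv)

lemma differential_det:
  assumes "K \<in> Sym" "w \<in> Sym" shows "differential det K w = dot3 (polar (coords K)) (coords w)"
proof -
  have "(\<lambda>t. det (K + t *\<^sub>c w)) = (\<lambda>t. det_form (coords K + t *s coords w))"
    using assms by (simp add: det_Sym Sym_add Sym_cmul)
  moreover have "((\<lambda>t. det_form (coords K + t *s coords w)) has_field_derivative dot3 (polar (coords K)) (coords w)) (at 0)"
    unfolding det_form_def dot3_def by (auto intro!: derivative_eq_intros simp: algebra_simps)
  ultimately show ?thesis unfolding differential_def by (simp add: DERIV_imp_deriv)
qed

section \<open>Critical points on a curve of symmetric matrices\<close>

locale plane_curve =
  fixes f :: poly3 and d :: nat and X :: "cmat set set" and a :: "complex^3 \<Rightarrow> complex^3"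
  assumes irr: "irreducible f" and hom_f: "homogeneous d f" and X: "X = proj_zeros (peval f)"
    and d1: "d > 1" and not_in_det: "\<not> X \<subseteq> proj_zeros det"
    and grad_f: "has_gradient (ev3 f) a"
begin

lemma cone: "affine_cone X = {K \<in> Sym. ev3 f (coords K) = 0}"
proof -
  have "ev3 f 0 = 0" using homogeneous_scale[OF hom_f, of 0 0] d1 by (simp add: zero_power)
  then show ?thesis
    unfolding X using affine_cone_proj_zeros[of "peval f"] homogeneous_scale[OF hom_f]
    by (simp add: peval_ev3)
qed

lemma exists_not_det: "\<exists>v. ev3 f v = 0 \<and> det_form v \<noteq> 0"
proof -
  obtain x where x: "x \<in> proj_zeros (peval f)" "x \<notin> proj_zeros det" using not_in_det X by blast
  then obtain K where "K \<in> x" "det K \<noteq> 0" "peval f K = 0" "x \<in> proj_points"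
    by (auto simp: proj_zeros_def)
  moreover have "K \<in> Sym"
    using \<open>K \<in> x\<close> \<open>x \<in> proj_points\<close> Sym_cmul by (auto simp: proj_points_def span_cmat_singleton)
  ultimately show ?thesis by (auto simp: det_Sym peval_ev3)
qed

sublocale curve_cone "ev3 f" a d
proof
  show "polyfun (ev3 f)" by (rule polyfun_ev3)
  show "(\<forall>v. ev3 f v = 0 \<longrightarrow> \<phi> v = 0) \<or> (\<forall>v. ev3 f v = 0 \<longrightarrow> \<psi> v = 0)"
    if pf: "polyfun \<phi>" "polyfun \<psi>" and z: "\<And>v. ev3 f v = 0 \<Longrightarrow> \<phi> v * \<psi> v = 0" for \<phi> \<psi>
  proof -
    obtain g h where gh: "\<phi> = ev3 g" "\<psi> = ev3 h" using pf polyfun_imp_ev3 by blast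
    have "f dvd g * h" by (rule nullstellensatz3[OF irr]) (use z gh in simp)
    then have "f dvd g \<or> f dvd h"
      by (rule prime_elem_dvd_multD[OF irreducible_imp_prime_elem_gcd[OF irr]])
    then show ?thesis unfolding gh by auto
  qed
  show "\<exists>m. polyfun m \<and> (\<forall>v. \<phi> v = ev3 f v * m v)"
    if pf: "polyfun \<phi>" and z: "\<And>v. ev3 f v = 0 \<Longrightarrow> \<phi> v = 0" for \<phi>
  proof -
    obtain g where g: "\<phi> = ev3 g" using pf polyfun_imp_ev3 by blast
    have "f dvd g" by (rule nullstellensatz3[OF irr]) (use z g in simp)
    then obtain h where "g = f * h" by blast
    then show ?thesis unfolding g using polyfun_ev3[of h] by auto
  qed
  show "ev3 f (s *s v) = s ^ d * ev3 f v" for s v by (rule homogeneous_scale[OF hom_f])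
  show "\<exists>v. ev3 f v \<noteq> 0" using irr by (intro ev3_nonzero) auto
qed (use d1 grad_f exists_not_det in auto)

text \<open>By the Nullstellensatz each polynomial of the vanishing ideal is f h, and where f = 0
  the product rule leaves only h times the gradient of f.\<close>

lemma tangent_space_cone:
  assumes "K \<in> affine_cone X"
  shows "tangent_space (affine_cone X) K = {w \<in> Sym. dot3 (a (coords K)) (coords w) = 0}"
proof (intro set_eqI iffI)
  fix w assume "w \<in> tangent_space (affine_cone X) K"
  moreover have "f \<in> vanishing_ideal (affine_cone X)"
    by (auto simp: vanishing_ideal_def cone peval_ev3)
  ultimately show "w \<in> {w \<in> Sym. dot3 (a (coords K)) (coords w) = 0}"
    using differential_peval[OF grad_f] by (auto simp: tangent_space_def)
next
  fix w assume w: "w \<in> {w \<in> Sym. dot3 (a (coords K)) (coords w) = 0}"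
  have "differential (peval g) K w = 0" if g: "g \<in> vanishing_ideal (affine_cone X)" for g
  proof -
    have "ev3 g v = 0" if "ev3 f v = 0" for v
    proof -
      have "sym_mat v \<in> affine_cone X" using that by (simp add: cone)
      then have "peval g (sym_mat v) = 0" using g by (simp add: vanishing_ideal_def)
      then show ?thesis by (simp add: peval_ev3)
    qed
    then have "f dvd g" by (intro nullstellensatz3[OF irr])
    then obtain h where h: "g = f * h" by blast
    obtain H where H: "has_gradient (ev3 h) H" using polyfun_has_gradient[OF polyfun_ev3] by blast
    have "has_gradient (ev3 g) (\<lambda>v. ev3 h v *s a v + ev3 f v *s H v)"
      using has_gradient_mult[OF grad_f H polyfun_ev3 polyfun_ev3] by (simp add: h ev3_mult[abs_def])
    then show ?thesis using differential_peval w assms by (simp add: cone)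
  qed
  then show "w \<in> tangent_space (affine_cone X) K" using w by (auto simp: tangent_space_def)
qed

text \<open>The critical equation is linear in the tangent vector, so it can be tested on the basis
  K, \<open>\<gamma> K\<close> of the tangent plane.\<close>

lemma critical_point_iff:
  assumes S: "S \<in> Sym"
  shows "critical_point X S K \<longleftrightarrow> K \<in> Sym \<and> crit (dual_coords S) (coords K)"
proof (cases "K \<in> affine_cone X")
  case False
  then show ?thesis
    by (auto simp: critical_point_def cone_open_part_def regular_points_def crit_def cone)
next
  case True
  define k where "k = coords K"
  have K: "K \<in> Sym" "ev3 f k = 0" using True by (auto simp: cone k_def)
  note T = tangent_space_cone[OF True, folded k_def]
  have reg: "K \<in> regular_points 2 (affine_cone X) \<longleftrightarrow> a k \<noteq> 0"
    unfolding regular_points_def using True T by (simp add: dim_hyperplane)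
  have "(\<forall>w\<in>{w \<in> Sym. dot3 (a k) (coords w) = 0}. differential det K w / det K - trace (S ** w) = 0)
      \<longleftrightarrow> dot3 (dual_coords S) k = 2 \<and> dot3 (dual_coords S) (\<gamma> k) = 0"
    if ak: "a k \<noteq> 0" and q: "det_form k \<noteq> 0"
  proof -
    have eq: "(differential det K w / det K - trace (S ** w) = 0) \<longleftrightarrow>
        dot3 (polar k) (coords w) = det_form k * dot3 (dual_coords S) (coords w)" if "w \<in> Sym" for w
      using that K S q by (simp add: differential_det trace_Sym det_Sym k_def[symmetric] field_simps)
    have pk: "dot3 (polar k) k = 2 * det_form k" by (rule dot_polar_self)
    have pg: "dot3 (polar k) (\<gamma> k) = 0" by (simp add: \<gamma>_def dot3_def) algebra
    have gk: "cross k (\<gamma> k) \<noteq> 0" using cross_\<gamma>[OF K(2)] ak q by (simp add: vec_eq_iff)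
    show ?thesis
    proof (intro iffI ballI conjI)
      assume *: "\<forall>w\<in>{w \<in> Sym. dot3 (a k) (coords w) = 0}.
          differential det K w / det K - trace (S ** w) = 0"
      have **: "dot3 (polar k) v = det_form k * dot3 (dual_coords S) v" if "dot3 (a k) v = 0" for v
        using *[rule_format, of "sym_mat v"] eq[of "sym_mat v"] that by simp
      show "dot3 (dual_coords S) k = 2" using **[OF euler[OF K(2)]] pk q by simp
      show "dot3 (dual_coords S) (\<gamma> k) = 0" using **[OF dot_a_\<gamma>] pg q by simp
    next
      fix w assume *: "dot3 (dual_coords S) k = 2 \<and> dot3 (dual_coords S) (\<gamma> k) = 0"
        and "w \<in> {w \<in> Sym. dot3 (a k) (coords w) = 0}"
      then have w: "w \<in> Sym" "dot3 (a k) (coords w) = 0" by auto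
      \<comment> \<open>x removes the component along k. The remainder is killed by
        \<open>polar k\<close> and \<open>a k\<close>, hence is a multiple of their cross product
        \<open>\<gamma> k\<close>.\<close>
      define x where "x = dot3 (polar k) (coords w) / (2 * det_form k)"
      define u where "u = coords w - x *s k"
      have u: "dot3 (a k) u = 0" "dot3 (polar k) u = 0"
        using w(2) euler[OF K(2)] pk q by (simp_all add: u_def x_def)
      have "cross u (\<gamma> k) = dot3 (a k) u *s polar k - dot3 (polar k) u *s a k"
        by (simp add: \<gamma>_def vec3_simps) algebra
      then have "cross u (\<gamma> k) = 0" using u by (simp add: vec_eq_iff)
      moreover have "\<gamma> k \<noteq> 0" using gk by (auto simp: vec3_simps)
      ultimately obtain y where "u = y *s \<gamma> k" using cross_eq_0D by blast
      then have "coords w = x *s k + y *s \<gamma> k" by (simp add: u_def algebra_simps)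
      then show "differential det K w / det K - trace (S ** w) = 0"
        unfolding eq[OF w(1)] using * pk pg by simp
    qed
  qed
  then show ?thesis
    using reg K unfolding critical_point_def cone_open_part_def T crit_def k_def[symmetric]
    by (auto simp: det_Sym k_def)
qed

lemma likelihood_incidence_iff:
  "(K, S) \<in> likelihood_incidence X \<longleftrightarrow> S \<in> Sym \<and> K \<in> Sym \<and> crit (dual_coords S) (coords K)"
  using critical_point_iff by (auto simp: likelihood_incidence_def)

lemma MLD_1_imp_conic:
  assumes "MLD X = 1"
  shows "\<exists>A\<in>Sym. rank A = 1 \<and> X = proj_zeros (\<lambda>K. det K - (trace (A ** K))\<^sup>2)"
proof -
  have "proj_degree (likelihood_incidence X) = 1" using assms by (simp add: MLD_def split: if_splits)
  then have "general_fibre_card (likelihood_incidence X) 1" by (rule proj_degree_imp) simp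
  then obtain g w where g: "polyfun g" "g w \<noteq> 0"
    and fib: "\<And>S. S \<in> Sym \<Longrightarrow> g (coords S) \<noteq> 0 \<Longrightarrow> card {K. (K, S) \<in> likelihood_incidence X} = 1"
    unfolding general_fibre_card_def generically_iff by blast
  \<comment> \<open>\<open>crit\<close> takes S in the doubled coordinates of
    \<open>dual_coords\<close>, whereas g is a polynomial in \<open>coords\<close>;
    \<open>half\<close> passes from the former to the latter.\<close>
  define half :: "complex^3 \<Rightarrow> complex^3" where "half v = vector [v$1, (1/2) * v$2, v$3]" for v
  have ph: "polymap half"
    using polyfun_mult[OF polyfun_const[of "1/2"] polyfun_coord[of 2]]
    unfolding polymap_iff half_def by (auto intro: polyfun_coord)
  have uniq: "\<exists>!v. crit S v" if S: "g (half S) \<noteq> 0" for S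
  proof -
    have dS: "dual_coords (sym_mat (half S)) = S" by (simp add: vec_eq_iff forall_3 half_def)
    have "card {K. (K, sym_mat (half S)) \<in> likelihood_incidence X} = 1" using fib S by simp
    then have "card {K \<in> Sym. crit S (coords K)} = 1"
      by (simp add: likelihood_incidence_iff dS)
    then obtain K where K: "{K \<in> Sym. crit S (coords K)} = {K}" by (rule card_1_singletonE)
    show ?thesis
    proof (rule ex1I[of _ "coords K"])
      show "crit S (coords K)" using K by blast
      fix v assume "crit S v"
      then have "sym_mat v \<in> {K}" unfolding K[symmetric] by simp
      then show "v = coords K" by (metis coords_sym_mat singletonD)
    qed
  qed
  have "half (vector [w$1, 2 * w$2, w$3]) = w" by (simp add: vec_eq_iff forall_3 half_def)
  then obtain p1 p2 t where p: "(p1, p2) \<noteq> (0, 0)"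
    "\<And>v. ev3 f v = 0 \<longleftrightarrow> det_form v = t * (p1\<^sup>2 * v$1 + 2 * p1 * p2 * v$2 + p2\<^sup>2 * v$3)\<^sup>2"
    using unique_critical_point_imp_conic[OF polyfun_compose[OF g(1) ph], of "vector [w$1, 2 * w$2, w$3]"]
      uniq g(2) by auto
  have t: "t \<noteq> 0" using exists_not_det p(2) by auto
  \<comment> \<open>The root of t is absorbed into the linear form: A is sqrt t times p p^T.\<close>
  define A where "A = sym_mat (csqrt t *s vector [p1\<^sup>2, p1 * p2, p2\<^sup>2])"
  have "A \<noteq> 0"
  proof
    assume "A = 0"
    then have "coords A = 0" by simp
    then show False using p(1) t by (auto simp: A_def vec_eq_iff forall_3)
  qed
  moreover have "det A = 0"
    by (simp add: A_def det_Sym det_form_def power2_eq_square algebra_simps)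
  ultimately have "rank A = 1" unfolding rank_1_iff by blast
  moreover have "X = proj_zeros (\<lambda>K. det K - (trace (A ** K))\<^sup>2)"
    unfolding X
  proof (rule proj_zeros_cong)
    fix K assume K: "K \<in> Sym"
    have AS: "A \<in> Sym" by (simp add: A_def)
    have "trace (A ** K) = csqrt t * (p1\<^sup>2 * coords K$1 + 2 * p1 * p2 * coords K$2 + p2\<^sup>2 * coords K$3)"
      unfolding trace_Sym[OF AS K] by (simp add: A_def dot3_def algebra_simps)
    then have "(trace (A ** K))\<^sup>2 = t * (p1\<^sup>2 * coords K$1 + 2 * p1 * p2 * coords K$2 + p2\<^sup>2 * coords K$3)\<^sup>2"
      by (simp only: power_mult_distrib power2_csqrt)
    then show "peval f K = 0 \<longleftrightarrow> det K - (trace (A ** K))\<^sup>2 = 0"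
      unfolding peval_ev3 p(2) det_Sym[OF K] by simp
  qed
  moreover have "A \<in> Sym" by (simp add: A_def)
  ultimately show ?thesis by blast
qed

end

section \<open>Conics given by a matrix of rank one\<close>

definition coord1 :: poly3 where "coord1 = [:0, 1:]"
definition coord2 :: poly3 where "coord2 = [:[:0, 1:]:]"
definition coord3 :: poly3 where "coord3 = [:[:[:0, 1:]:]:]"
definition scalar3 :: "complex \<Rightarrow> poly3" where "scalar3 c = [:[:[:c:]:]:]"

lemma ev3_simps [simp]:
  "ev3 coord1 v = v $ 1" "ev3 coord2 v = v $ 2" "ev3 coord3 v = v $ 3" "ev3 (scalar3 c) v = c"
  "ev3 1 v = 1" "ev3 (f + g) v = ev3 f v + ev3 g v" "ev3 (f - g) v = ev3 f v - ev3 g v" "ev3 (f ^ n) v = ev3 f v ^ n"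
  by (simp_all add: ev3_def coord1_def coord2_def coord3_def scalar3_def)

lemma ev3_eq_iff: "(\<forall>v. ev3 f v = ev3 g v) \<longleftrightarrow> f = g"
  using ev3_eq_0_iff[of "f - g"] by simp

lemma homogeneous_coord:
  "homogeneous 1 coord1" "homogeneous 1 coord2" "homogeneous 1 coord3" "homogeneous 0 (scalar3 c)"
  by (auto simp: homogeneous_def coord1_def coord2_def coord3_def scalar3_def coeff_pCons
      split: nat.splits)

lemma homogeneous_add: "homogeneous d f \<Longrightarrow> homogeneous d g \<Longrightarrow> homogeneous d (f + g)"
  by (force simp: homogeneous_def)

lemma homogeneous_diff: "homogeneous d f \<Longrightarrow> homogeneous d g \<Longrightarrow> homogeneous d (f - g)"
  by (force simp: homogeneous_def)

lemma homogeneous_mult: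
  assumes "homogeneous d f" "homogeneous e g" shows "homogeneous (d + e) (f * g)"
  unfolding homogeneous_def
proof (intro allI impI)
  fix i j k assume nz: "coeff (coeff (coeff (f * g) i) j) k \<noteq> 0"
  have "coeff (coeff (coeff (f * g) i) j) k = (\<Sum>l\<le>i. \<Sum>m\<le>j. \<Sum>n\<le>k.
      coeff (coeff (coeff f l) m) n * coeff (coeff (coeff g (i - l)) (j - m)) (k - n))"
    by (simp add: coeff_mult coeff_sum)
  then obtain l m n where "l \<le> i" "m \<le> j" "n \<le> k"
      "coeff (coeff (coeff f l) m) n * coeff (coeff (coeff g (i - l)) (j - m)) (k - n) \<noteq> 0"
    using nz by (metis (no_types, lifting) atMost_iff sum.not_neutral_contains_not_neutral)
  moreover from this have "coeff (coeff (coeff f l) m) n \<noteq> 0"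
      "coeff (coeff (coeff g (i - l)) (j - m)) (k - n) \<noteq> 0" by auto
  then have "l + m + n = d" "(i - l) + (j - m) + (k - n) = e"
    using assms unfolding homogeneous_def by blast+
  ultimately show "i + j + k = d + e" by linarith
qed

section \<open>Factors of a quadratic form\<close>

lemma exists_orthogonal: "\<exists>v. v \<noteq> 0 \<and> dot3 u v = 0"
proof (cases "u $ 1 = 0 \<and> u $ 2 = 0")
  case True
  then have "axis 1 1 \<noteq> (0 :: complex^3) \<and> dot3 u (axis 1 1) = 0"
    by (simp add: vec3_simps axis_def)
  then show ?thesis by blast
next
  case False
  then have "vector [u $ 2, - u $ 1, 0] \<noteq> (0 :: complex^3) \<and> dot3 u (vector [u $ 2, - u $ 1, 0]) = 0"
    by (auto simp: vec3_simps)
  then show ?thesis by blast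
qed

text \<open>Two lines in the projective plane meet; this gives the singular point of a product of
  two linear forms.\<close>

lemma exists_orthogonal_pair: "\<exists>v. v \<noteq> 0 \<and> dot3 u v = 0 \<and> dot3 w v = 0"
proof (cases "cross u w = 0")
  case True
  show ?thesis
  proof (cases "w = 0")
    case False
    then obtain s where "u = s *s w" using cross_eq_0D[OF True] by blast
    then show ?thesis using exists_orthogonal[of w] by auto
  qed (use exists_orthogonal in auto)
next
  case False
  have "dot3 u (cross u w) = 0" "dot3 w (cross u w) = 0" by (simp_all add: dot3_def algebra_simps)
  then show ?thesis using False by blast
qed

text \<open>A root of p would be a root of s^n, hence 0, where p is nonzero.\<close>

lemma poly_mult_monom_root:
  fixes p q :: "complex poly"
  assumes "\<And>s. poly p s * poly q s = c * s ^ n" "c \<noteq> 0" "poly p 0 \<noteq> 0"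
  shows "poly p s = poly p 0"
proof (cases "degree p = 0")
  case True
  then show ?thesis by (metis degree_eq_zeroE mult_zero_right poly_0 poly_pCons add_0_right)
next
  case False
  then obtain x where x: "poly p x = 0" using alg_closed_imp_poly_has_root[of p] by auto
  then have "c * x ^ n = 0" using assms(1)[of x] by simp
  then show ?thesis using assms(2,3) x by simp
qed

text \<open>Along a ray with nonzero product, G and H multiply to c s^2. A factor that is nonzero at
  0 has no root, hence is constant; if both vanish at 0, dividing each by s leaves constants.
  Density extends this to all rays.\<close>

lemma homogeneous_quadratic_factor:
  assumes pf: "polyfun G" "polyfun H" and hom: "\<And>s v. G (s *s v) * H (s *s v) = s\<^sup>2 * (G v * H v)"
    and nz: "G x * H x \<noteq> 0"
  shows "(\<forall>v. G v = G 0 \<and> G 0 \<noteq> 0) \<or> (\<forall>v. H v = H 0 \<and> H 0 \<noteq> 0) \<or>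
    (\<forall>s v. G (s *s v) = s * G v \<and> H (s *s v) = s * H v)"
proof -
  note pm = polyfun_mult[OF pf]
  have const: "\<forall>v. G v = G 0" if G0: "G 0 \<noteq> 0" and pf: "polyfun G" "polyfun H"
    and hom: "\<And>s v. G (s *s v) * H (s *s v) = s\<^sup>2 * (G v * H v)" and nz: "G x * H x \<noteq> 0" for G H
  proof -
    have "G v - G 0 = 0" for v
    proof (rule polyfun_mult_eq_0[where \<phi> = "\<lambda>v. G v - G 0", OF _ polyfun_mult[OF pf] _ nz])
      show "polyfun (\<lambda>v. G v - G 0)" by (intro polyfun_rules pf)
      fix v
      obtain g where g: "\<And>t. poly g t = G (0 + t *s v)" using polyfun_line[OF pf(1)] by blast
      obtain h where h: "\<And>t. poly h t = H (0 + t *s v)" using polyfun_line[OF pf(2)] by blast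
      have "poly g 1 = poly g 0" if "G v * H v \<noteq> 0"
        by (rule poly_mult_monom_root[of g h "G v * H v" 2]) (use that hom g h G0 in \<open>simp_all add: mult.commute\<close>)
      then show "(G v - G 0) * (G v * H v) = 0" using g[of 0] g[of 1] by auto
    qed
    then show ?thesis by simp
  qed
  have lin: "\<forall>s v. G (s *s v) = s * G v" if G0: "G 0 = 0" "H 0 = 0" and pf: "polyfun G" "polyfun H"
    and hom: "\<And>s v. G (s *s v) * H (s *s v) = s\<^sup>2 * (G v * H v)" and nz: "G x * H x \<noteq> 0" for G H
  proof -
    have "G (s *s v) - s * G v = 0" for s v
    proof (rule polyfun_mult_eq_0[where \<phi> = "\<lambda>v. G (s *s v) - s * G v", OF _ polyfun_mult[OF pf] _ nz])
      show "polyfun (\<lambda>v. G (s *s v) - s * G v)"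
        by (intro polyfun_rules pf polyfun_compose[OF pf(1)] polymap_rules)
      fix v
      obtain g where g: "\<And>t. poly g t = G (0 + t *s v)" using polyfun_line[OF pf(1)] by blast
      obtain h where h: "\<And>t. poly h t = H (0 + t *s v)" using polyfun_line[OF pf(2)] by blast
      have "[:0,1:] dvd g" "[:0,1:] dvd h"
        using g[of 0] h[of 0] G0 poly_eq_0_iff_dvd[of g 0] poly_eq_0_iff_dvd[of h 0] by simp_all
      then obtain g' h' where g': "g = [:0,1:] * g'" and h': "h = [:0,1:] * h'" by (auto elim!: dvdE)
      have "poly g' s = poly g' 1" if nzv: "G v * H v \<noteq> 0"
      proof -
        define P where "P = g' * h' - [:G v * H v:]"
        have "poly P s = 0" if "s \<noteq> 0" for s
        proof -
          have "poly g s * poly h s = s\<^sup>2 * (G v * H v)" using g h hom by simp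
          then show ?thesis using that by (simp add: g' h' P_def power2_eq_square)
        qed
        then have P: "poly P s = 0" for s by (rule poly_zero_off_0)
        have gh: "poly g' s * poly h' s = G v * H v * s ^ 0" for s using P[of s] by (simp add: P_def)
        then have "poly g' 0 \<noteq> 0" using nzv by (metis mult_eq_0_iff power_0 mult.right_neutral)
        then show ?thesis using poly_mult_monom_root[OF gh nzv] by metis
      qed
      then show "(G (s *s v) - s * G v) * (G v * H v) = 0"
        using g[of s] g[of 1] by (cases "G v * H v = 0") (simp_all add: g')
    qed
    then show ?thesis by simp
  qed
  show ?thesis
  proof (cases "G 0 = 0")
    case False
    then show ?thesis using const[OF False pf hom nz] by blast
  next
    case G0: True
    have hom': "H (s *s v) * G (s *s v) = s\<^sup>2 * (H v * G v)" for s v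
      using hom[of s v] by (simp add: mult.commute)
    have nz': "H x * G x \<noteq> 0" using nz by (simp add: mult.commute)
    show ?thesis
    proof (cases "H 0 = 0")
      case False
      then show ?thesis using const[OF False pf(2,1) hom' nz'] by blast
    next
      case True
      then show ?thesis using lin[OF G0 True pf hom nz] lin[OF True G0 pf(2,1) hom' nz'] by blast
    qed
  qed
qed

lemma linear_polyfun:
  assumes "polyfun G" "\<And>s v. G (s *s v) = s * G v" shows "\<exists>u. \<forall>v. G v = dot3 u v"
proof -
  obtain D where D: "has_gradient G D" using polyfun_has_gradient[OF assms(1)] by blast
  have "G v = dot3 (D 0) v" for v
  proof -
    have "((\<lambda>t. G (0 + t *s v)) has_field_derivative dot3 (D 0) v) (at 0)"
      using has_gradient_line[OF D, of 0 v 0] by simp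
    moreover have "((\<lambda>t. G (0 + t *s v)) has_field_derivative G v) (at 0)"
      using assms(2) by (auto intro!: derivative_eq_intros)
    ultimately show ?thesis by (rule DERIV_unique[symmetric])
  qed
  then show ?thesis by blast
qed

lemma scalar3_1 [simp]: "scalar3 1 = 1"
  by (simp add: scalar3_def one_pCons)

lemma ev3_const_unit:
  assumes "\<And>v. ev3 g v = c" "c \<noteq> 0" shows "g dvd 1"
proof -
  have "g * scalar3 (1 / c) = 1"
    using ev3_eq_iff[of "g * scalar3 (1 / c)" "scalar3 1"] assms
    by simp
  then show ?thesis by (metis dvd_triv_left)
qed

section \<open>Smoothness and irreducibility of the conic\<close>

locale rank_one =
  fixes A :: cmat
  assumes A: "A \<in> Sym" and rank_A: "rank A = 1"
begin

abbreviation "a11 \<equiv> A $ 1 $ 1"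
abbreviation "a12 \<equiv> A $ 1 $ 2"
abbreviation "a22 \<equiv> A $ 2 $ 2"

lemma det_A: "a11 * a22 = a12 * a12" and A_nonzero: "a11 \<noteq> 0 \<or> a22 \<noteq> 0"
proof -
  have "A \<noteq> 0" "det A = 0" using rank_A unfolding rank_1_iff by auto
  then show 1: "a11 * a22 = a12 * a12" using A by (simp add: det_2 Sym_iff)
  show "a11 \<noteq> 0 \<or> a22 \<noteq> 0"
    using \<open>A \<noteq> 0\<close> 1 A by (auto simp: vec_eq_iff forall_2 Sym_iff)
qed

definition lin :: poly3 where
  "lin = scalar3 a11 * coord1 + scalar3 (2 * a12) * coord2 + scalar3 a22 * coord3"

definition conic :: poly3 where
  "conic = coord1 * coord3 - coord2 * coord2 - lin * lin"

lemma ev3_conic: "ev3 conic v = det_form v - (dot3 (dual_coords A) v)\<^sup>2"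
  by (simp add: conic_def lin_def det_form_def dot3_def power2_eq_square)

lemma homogeneous_conic: "homogeneous 2 conic"
proof -
  have "homogeneous (0 + 1) lin"
    unfolding lin_def by (intro homogeneous_add homogeneous_mult homogeneous_coord)
  then have "homogeneous (1 + 1) conic"
    unfolding conic_def by (intro homogeneous_diff homogeneous_mult homogeneous_coord) simp_all
  then show ?thesis by (simp add: numeral_2_eq_2)
qed

definition conic_grad :: "complex^3 \<Rightarrow> complex^3" where
  "conic_grad v = polar v - (2 * dot3 (dual_coords A) v) *s dual_coords A"

lemma has_gradient_conic: "has_gradient (ev3 conic) conic_grad"
  unfolding has_gradient_def
proof (intro conjI allI impI)
  show "polymap conic_grad"
    unfolding conic_grad_def[abs_def] by (intro polyfun_intros)
  fix k :: "complex \<Rightarrow> complex^3" and k' t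
  assume "\<forall>i. ((\<lambda>t. k t $ i) has_field_derivative k' $ i) (at t)"
  then have k: "((\<lambda>t. k t $ i) has_field_derivative k' $ i) (at t)" for i by blast
  show "((\<lambda>t. ev3 conic (k t)) has_field_derivative dot3 (conic_grad (k t)) k') (at t)"
    unfolding ev3_conic det_form_def dot3_def
    by (rule derivative_eq_intros k refl)+ (simp add: conic_grad_def dot3_def algebra_simps)
qed

text \<open>Such a v is s times the adjugate of A, which is singular like A.\<close>

lemma polar_multiple_A: "polar v = s *s dual_coords A \<Longrightarrow> det_form v = 0"
proof -
  assume "polar v = s *s dual_coords A"
  then have *: "polar v $ i = (s *s dual_coords A) $ i" for i by (rule arg_cong)
  have "- 2 * v $ 2 = s * (2 * a12)"
    using *[of 2] by (simp only: polar_nth dual_coords_nth vector_smult_component)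
  then have "v $ 2 = - (s * a12)" by algebra
  moreover have "v $ 3 = s * a11" "v $ 1 = s * a22"
    using *[of 1] *[of 3] by (simp_all only: polar_nth dual_coords_nth vector_smult_component)
  ultimately have e: "v $ 3 = s * a11" "v $ 2 = - (s * a12)" "v $ 1 = s * a22" by blast+
  have "det_form v = s * s * (a11 * a22 - a12 * a12)"
    unfolding det_form_def e by (simp add: algebra_simps)
  then show ?thesis using det_A by simp
qed

text \<open>A vanishing gradient makes v equal to 2 l adj(A), where l is the value of A at v. But A
  pairs with its adjugate to 2 det A = 0, so l = 0.\<close>

lemma conic_grad_eq_0: "conic_grad v = 0 \<Longrightarrow> v = 0"
proof -
  assume "conic_grad v = 0"
  define l where "l = dot3 (dual_coords A) v"
  have "conic_grad v $ i = 0" for i using \<open>conic_grad v = 0\<close> by simp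
  from this[of 1] this[of 2] this[of 3]
  have e1: "v $ 3 - 2 * l * a11 = 0" "- 2 * v $ 2 - 2 * l * (2 * a12) = 0" "v $ 1 - 2 * l * a22 = 0"
    unfolding conic_grad_def l_def[symmetric] vector_minus_component vector_smult_component
      polar_nth dual_coords_nth by blast+
  have e: "v $ 3 = 2 * l * a11" "v $ 1 = 2 * l * a22" using e1(1,3) by algebra+
  have e2: "v $ 2 = - (2 * l * a12)" using e1(2) by algebra
  have "l = a11 * v$1 + 2 * a12 * v$2 + a22 * v$3" by (simp add: l_def dot3_def)
  then have "l = 0" unfolding e e2 using det_A by algebra
  then show "v = 0" using e e2 by (simp add: vec_eq_iff forall_3)
qed

text \<open>A proper factorisation is into two linear forms, whose common zero would be a singular
  point.\<close>

lemma irreducible_conic: "irreducible conic"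
proof (rule irreducibleI)
  have e: "ev3 conic (vector [1, x, 0]) \<noteq> 0" if "x = (if a11 = 0 then 1 else 0)" for x
    using that det_A A_nonzero by (auto simp: ev3_conic det_form_def dot3_def)
  then show "conic \<noteq> 0" by (metis ev3_eq_0_iff)
  have ev0: "ev3 conic 0 = 0" by (simp add: ev3_conic det_form_def)
  show "\<not> conic dvd 1"
  proof
    assume "conic dvd 1"
    then obtain h where "1 = conic * h" by blast
    then have "ev3 1 0 = 0" using ev0 by (metis ev3_mult mult_zero_left)
    then show False by (simp add: ev3_def)
  qed
  fix g h assume gh: "conic = g * h"
  have "ev3 g (s *s v) * ev3 h (s *s v) = s\<^sup>2 * (ev3 g v * ev3 h v)" for s v
    using homogeneous_scale[OF homogeneous_conic, of s v] by (simp add: gh)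
  moreover have "ev3 g x * ev3 h x \<noteq> 0" if "x = vector [1, if a11 = 0 then 1 else 0, 0]" for x
    using e[OF refl] unfolding gh ev3_mult that .
  ultimately consider "\<forall>v. ev3 g v = ev3 g 0 \<and> ev3 g 0 \<noteq> 0" | "\<forall>v. ev3 h v = ev3 h 0 \<and> ev3 h 0 \<noteq> 0"
    | "\<forall>s v. ev3 g (s *s v) = s * ev3 g v \<and> ev3 h (s *s v) = s * ev3 h v"
    using homogeneous_quadratic_factor[OF polyfun_ev3 polyfun_ev3, of g h] by blast
  then show "g dvd 1 \<or> h dvd 1"
  proof cases
    case 1
    then show ?thesis using ev3_const_unit[of g] by blast
  next
    case 2
    then show ?thesis using ev3_const_unit[of h] by blast
  next
    case 3
    obtain u where u: "\<And>v. ev3 g v = dot3 u v" using linear_polyfun[OF polyfun_ev3, of g] 3 by blast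
    obtain w where w: "\<And>v. ev3 h v = dot3 w v" using linear_polyfun[OF polyfun_ev3, of h] 3 by blast
    obtain v where v: "v \<noteq> 0" "dot3 u v = 0" "dot3 w v = 0" using exists_orthogonal_pair by blast
    have "dot3 (conic_grad v) x = 0" for x
    proof -
      have "((\<lambda>t. ev3 conic (v + t *s x)) has_field_derivative dot3 (conic_grad v) x) (at 0)"
        using has_gradient_line[OF has_gradient_conic, of v x 0] by simp
      moreover have "ev3 conic (v + t *s x) = t\<^sup>2 * (dot3 u x * dot3 w x)" for t
        using v by (simp add: gh u w power2_eq_square)
      moreover have "((\<lambda>t::complex. t\<^sup>2 * (dot3 u x * dot3 w x)) has_field_derivative 0) (at 0)"
        by (auto intro!: derivative_eq_intros)
      ultimately show ?thesis by (simp add: DERIV_unique)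
    qed
    then have "conic_grad v = 0"
      using dot3_nondegenerate[of "conic_grad v"] by (metis dot3_def mult.commute)
    then show ?thesis using conic_grad_eq_0 v(1) by blast
  qed
qed

text \<open>The pairing of S with the adjugate of A, that is, the coefficient of t in det (S + t
  A).\<close>

definition ul :: "complex^3 \<Rightarrow> complex" where
  "ul v = a22 * v$1 + a11 * v$3 - 2 * a12 * v$2"

definition Dq :: "complex^3 \<Rightarrow> complex" where
  "Dq v = det_form v + (ul v)\<^sup>2"

text \<open>At a critical point, S is a Lagrange combination of \<open>polar v\<close> and A.
  Solving for the multipliers gives Dq / 2 and n = Dq / ul - 2 ul, so the point is 2 / Dq times the
  adjugate of S - n A.\<close>

definition mle :: "complex^3 \<Rightarrow> complex^3" where
  "mle v = (2 / Dq v) *s vector [v$3 - (Dq v / ul v - 2 * ul v) * a22,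
     (Dq v / ul v - 2 * ul v) * a12 - v$2, v$1 - (Dq v / ul v - 2 * ul v) * a11]"

lemma polyfun_ul: "polyfun ul"
  unfolding ul_def[abs_def] by (intro polyfun_rules)

lemma polyfun_Dq: "polyfun Dq"
  using polyfun_det_form[OF polymap_id] unfolding Dq_def[abs_def] by (intro polyfun_rules polyfun_ul) simp

lemma exists_general: "\<exists>v. ul v * Dq v \<noteq> 0"
proof (cases "a11 = 0")
  case False
  then have "ul (axis 3 1) * Dq (axis 3 1) \<noteq> 0"
    by (simp add: ul_def Dq_def det_form_def axis_def)
  then show ?thesis by blast
next
  case True
  then have "ul (axis 1 1) * Dq (axis 1 1) \<noteq> 0"
    using A_nonzero by (simp add: ul_def Dq_def det_form_def axis_def)
  then show ?thesis by blast
qed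

lemma generically_general:
  assumes "\<And>S. S \<in> Sym \<Longrightarrow> ul (coords S) \<noteq> 0 \<Longrightarrow> Dq (coords S) \<noteq> 0 \<Longrightarrow> P S" shows "generically P"
proof -
  obtain w where "ul w * Dq w \<noteq> 0" using exists_general by blast
  then show ?thesis unfolding generically_iff
    using assms polyfun_mult[OF polyfun_ul polyfun_Dq]
    by (intro exI[of _ "\<lambda>v. ul v * Dq v"] exI[of _ w]) auto
qed

section \<open>Explicit solution of the critical equations\<close>

context
  fixes S :: cmat
  assumes S: "S \<in> Sym" and u0: "ul (coords S) \<noteq> 0" and D0: "Dq (coords S) \<noteq> 0"
begin

lemma mle_props:
  defines "v \<equiv> mle (coords S)"
  shows "dot3 (dual_coords A) v = 2 * ul (coords S) / Dq (coords S)" and "det_form v = (2 * ul (coords S) / Dq (coords S))\<^sup>2"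
    and "dot3 (dual_coords S) v = 2" and "dot3 (dual_coords S) (cross (polar v) (dual_coords A)) = 0"
proof -
  define u D where "u = ul (coords S)" and "D = Dq (coords S)"
  define k where "k = D / u - 2 * u"
  define x y z where "x = S$1$1" and "y = S$1$2" and "z = S$2$2"
  have u: "u = a22 * x + a11 * z - 2 * a12 * y"
    by (simp add: u_def ul_def x_def y_def z_def)
  have D: "D = x * z - y * y + u * u"
    by (simp add: D_def Dq_def det_form_def u_def x_def y_def z_def power2_eq_square)
  have nz: "u \<noteq> 0" "D \<noteq> 0" using u0 D0 by (simp_all add: u_def D_def)
  have ku: "k * u = D - 2 * u * u" using nz by (simp add: k_def field_simps)
  have v: "v$1 = (2 / D) * (z - k * a22)" "v$2 = (2 / D) * (k * a12 - y)" "v$3 = (2 / D) * (x - k * a11)"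
    unfolding v_def mle_def by (simp_all add: k_def u_def D_def x_def y_def z_def)
  have "dot3 (dual_coords A) v = (2 / D) * (a11 * (z - k * a22) + 2 * a12 * (k * a12 - y) + a22 * (x - k * a11))"
    unfolding dot3_def v by (simp add: algebra_simps)
  also have "a11 * (z - k * a22) + 2 * a12 * (k * a12 - y) + a22 * (x - k * a11) = u"
    using det_A unfolding u by algebra
  finally show "dot3 (dual_coords A) v = 2 * ul (coords S) / Dq (coords S)" by (simp add: u_def D_def)
  have "det_form v = (2 / D)\<^sup>2 * ((z - k * a22) * (x - k * a11) - (k * a12 - y) * (k * a12 - y))"
    unfolding det_form_def v by algebra
  also have "(z - k * a22) * (x - k * a11) - (k * a12 - y) * (k * a12 - y) = u\<^sup>2"
    using det_A u D ku by algebra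
  finally show "det_form v = (2 * ul (coords S) / Dq (coords S))\<^sup>2"
    by (simp add: u_def D_def power_divide power_mult_distrib)
  have "dot3 (dual_coords S) v = (2 / D) * (x * (z - k * a22) + 2 * y * (k * a12 - y) + z * (x - k * a11))"
    unfolding dot3_def v by (simp add: x_def y_def z_def algebra_simps)
  also have "x * (z - k * a22) + 2 * y * (k * a12 - y) + z * (x - k * a11) = D"
    using u D ku by algebra
  finally show "dot3 (dual_coords S) v = 2" using nz by simp
  have pv: "polar v = (2 / D) *s (dual_coords S - k *s dual_coords A)"
    by (simp add: vec_eq_iff forall_3 v x_def y_def z_def algebra_simps)
  show "dot3 (dual_coords S) (cross (polar v) (dual_coords A)) = 0"
    unfolding pv by (simp add: dot3_def algebra_simps)
qed

lemma mle_unique: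
  assumes con: "det_form v = (dot3 (dual_coords A) v)\<^sup>2" and q: "det_form v \<noteq> 0" and t: "dot3 (dual_coords S) v = 2"
    and c: "dot3 (dual_coords S) (cross (polar v) (dual_coords A)) = 0"
  shows "v = mle (coords S)"
proof -
  define u D where "u = ul (coords S)" and "D = Dq (coords S)"
  define l where "l = dot3 (dual_coords A) v"
  have l0: "l \<noteq> 0" using con q by (auto simp: l_def)
  have A0: "dual_coords A \<noteq> 0" using A_nonzero by (auto simp: vec_eq_iff forall_3)
  have "cross (polar v) (dual_coords A) \<noteq> 0"
    using cross_eq_0D[OF _ A0] polar_multiple_A q by blast
  \<comment> \<open>The critical condition makes the cross products of S and of
    \<open>polar v\<close> with A parallel, which puts S in the span of \<open>polar v\<close> and
    A.\<close>
  moreover have "cross (cross s \<alpha>) (cross p \<alpha>) = dot3 s (cross p \<alpha>) *s \<alpha>" for s p \<alpha>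
    by (simp add: vec3_simps) algebra
  then have "cross (cross (dual_coords S) (dual_coords A)) (cross (polar v) (dual_coords A)) = 0" by (simp add: c)
  ultimately obtain m where m: "cross (dual_coords S) (dual_coords A) = m *s cross (polar v) (dual_coords A)" using cross_eq_0D by blast
  have "cross (dual_coords S - m *s polar v) (dual_coords A) = cross (dual_coords S) (dual_coords A) - m *s cross (polar v) (dual_coords A)"
    by (simp add: vec3_simps algebra_simps)
  then have "cross (dual_coords S - m *s polar v) (dual_coords A) = 0" using m by simp
  then obtain n where n: "dual_coords S - m *s polar v = n *s dual_coords A" using cross_eq_0D[OF _ A0] by blast
  have ni: "(dual_coords S - m *s polar v) $ i = (n *s dual_coords A) $ i" for i using n by (rule arg_cong)
  note ni = ni[unfolded vector_minus_component vector_smult_component]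
  have "S$1$1 - m * v$3 = n * a11" and "S$2$2 - m * v$1 = n * a22"
    using ni[of 1] ni[of 3] unfolding polar_nth dual_coords_nth by blast+
  then have x: "S$1$1 = m * v$3 + n * a11" and z: "S$2$2 = m * v$1 + n * a22" by algebra+
  have "2 * S$1$2 - m * (- 2 * v$2) = n * (2 * a12)" using ni[of 2] unfolding polar_nth dual_coords_nth by blast
  then have y: "S$1$2 = n * a12 - m * v$2" by algebra
  have l: "l = a11 * v$1 + 2 * a12 * v$2 + a22 * v$3" by (simp add: l_def dot3_def)
  have q2: "v$1 * v$3 - v$2 * v$2 = l * l" using con by (simp add: det_form_def l_def power2_eq_square)
  have u: "u = m * l"
    unfolding u_def ul_def coords_nth x y z l using det_A by algebra
  have t2: "2 = 2 * m * (l * l) + n * l"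
  proof -
    have "2 = dot3 (dual_coords S) v" using t by simp
    also have "\<dots> = 2 * m * (v$1 * v$3 - v$2 * v$2) + n * (a11 * v$1 + 2 * a12 * v$2 + a22 * v$3)"
      unfolding dot3_def dual_coords_nth x y z by (simp add: algebra_simps)
    finally show ?thesis unfolding q2 l .
  qed
  have "S$1$1 * S$2$2 - S$1$2 * S$1$2 = m * m * (l * l) + m * n * l"
    unfolding x y z using q2 l det_A by algebra
  then have D: "D = m * m * (l * l) + m * n * l + u * u"
    by (simp add: D_def Dq_def det_form_def u_def power2_eq_square)
  have m0: "m \<noteq> 0" using u u0 l0 by (auto simp: u_def)
  \<comment> \<open>As u = m l, D equals m (2 m l^2 + n l), and the bracket is 2 by
    \<open>t2\<close>.\<close>
  have D2: "D = 2 * m" using D u t2 by algebra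
  have "D / u - 2 * u = 2 / l - 2 * u" unfolding D2 using u m0 l0 by simp
  also have "\<dots> = n" using t2 l0 u by (simp add: field_simps)
  finally have k: "Dq (coords S) / ul (coords S) - 2 * ul (coords S) = n" by (simp add: D_def u_def)
  show ?thesis
    unfolding mle_def k unfolding D_def[symmetric] D2 using m0 by (simp add: vec_eq_iff forall_3 x y z)
qed

end

lemma conic_zeros: "proj_zeros (\<lambda>K. det K - (trace (A ** K))\<^sup>2) = proj_zeros (peval conic)"
  by (rule proj_zeros_cong) (simp add: peval_ev3 ev3_conic det_Sym trace_Sym[OF A])

text \<open>The explicit critical point is itself a point of the conic with nonzero
  determinant.\<close>

lemma conic_not_in_det: "\<not> proj_zeros (peval conic) \<subseteq> proj_zeros det"
proof -
  obtain w where w: "ul w * Dq w \<noteq> 0" using exists_general by blast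
  define v where "v = mle w"
  have v: "ev3 conic v = 0" "det_form v \<noteq> 0"
    using mle_props(1,2)[of "sym_mat w"] w by (simp_all add: ev3_conic v_def)
  have "cmat.span {sym_mat v} \<in> proj_points"
    using v(2) by (auto simp: proj_points_def det_form_def vec_eq_iff forall_2 intro!: exI[of _ "sym_mat v"])
  moreover have "peval conic K = 0" if "K \<in> cmat.span {sym_mat v}" for K
    using that v(1) homogeneous_scale[OF homogeneous_conic]
    by (auto simp: span_cmat_singleton peval_ev3)
  moreover have "sym_mat v \<in> cmat.span {sym_mat v}" by (rule cmat.span_base) simp
  moreover have "det (sym_mat v) \<noteq> 0" using v(2) by (simp add: det_Sym)
  ultimately show ?thesis by (auto simp: proj_zeros_def)
qed

sublocale plane_curve conic 2 "proj_zeros (peval conic)" conic_grad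
  by unfold_locales
    (use irreducible_conic homogeneous_conic conic_not_in_det has_gradient_conic in auto)

lemma crit_iff_mle:
  assumes "S \<in> Sym" "ul (coords S) \<noteq> 0" "Dq (coords S) \<noteq> 0"
  shows "crit (dual_coords S) v \<longleftrightarrow> v = mle (coords S)"
proof -
  \<comment> \<open>The gradient is \<open>polar v\<close> minus a multiple of A, so here
    \<open>\<gamma>\<close> maps into the line A = 0: A is the B of the converse direction.\<close>
  have \<gamma>: "\<gamma> v = (- 2 * dot3 (dual_coords A) v) *s cross (polar v) (dual_coords A)" for v
    by (simp add: \<gamma>_def conic_grad_def vec3_simps) algebra
  show ?thesis
  proof
    assume c: "crit (dual_coords S) v"
    then have q: "det_form v = (dot3 (dual_coords A) v)\<^sup>2" by (simp add: crit_def ev3_conic)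
    moreover have "det_form v \<noteq> 0" using c unfolding crit_def by blast
    ultimately have "dot3 (dual_coords A) v \<noteq> 0" by auto
    with q \<open>det_form v \<noteq> 0\<close> show "v = mle (coords S)"
      using c \<gamma>[of v] by (intro mle_unique[OF assms]) (auto simp: crit_def)
  next
    assume v: "v = mle (coords S)"
    note props = mle_props[OF assms, folded v]
    have "conic_grad v \<noteq> 0"
      using conic_grad_eq_0[of v] props(3) by auto
    then show "crit (dual_coords S) v"
      unfolding crit_def \<gamma> using props assms by (simp add: ev3_conic)
  qed
qed

lemma fibre:
  assumes "S \<in> Sym" "ul (coords S) \<noteq> 0" "Dq (coords S) \<noteq> 0"
  shows "(K, S) \<in> likelihood_incidence (proj_zeros (peval conic)) \<longleftrightarrow> K = sym_mat (mle (coords S))"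
proof -
  have "K \<in> Sym \<and> coords K = mle (coords S) \<longleftrightarrow> K = sym_mat (mle (coords S))"
    by (metis coords_sym_mat sym_mat_coords sym_mat_in_Sym)
  then show ?thesis using assms by (simp add: likelihood_incidence_iff crit_iff_mle)
qed

lemma MLD_conic: "MLD (proj_zeros (peval conic)) = 1"
proof -
  let ?R = "likelihood_incidence (proj_zeros (peval conic))"
  have "general_fibre_card ?R 1"
    unfolding general_fibre_card_def by (rule generically_general) (simp add: fibre)
  moreover have "zariski_dense (snd ` ?R)"
    unfolding zariski_dense_def
  proof (intro allI impI)
    fix g assume g: "\<forall>S\<in>snd ` ?R. peval g S = 0"
    obtain w where w: "ul w * Dq w \<noteq> 0" using exists_general by blast
    have "ev3 g v = 0" for v
    proof (rule polyfun_mult_eq_0[OF polyfun_ev3 polyfun_mult[OF polyfun_ul polyfun_Dq] _ w])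
      fix v
      have "ev3 g v = 0" if "ul v \<noteq> 0" "Dq v \<noteq> 0"
      proof -
        have "sym_mat v \<in> snd ` ?R"
          using fibre[of "sym_mat v"] that by (auto intro!: image_eqI[of _ _ "(sym_mat (mle v), sym_mat v)"])
        then have "peval g (sym_mat v) = 0" using g by blast
        then show ?thesis by (simp add: peval_ev3)
      qed
      then show "ev3 g v * (ul v * Dq v) = 0" by auto
    qed
    then show "g = 0" using ev3_eq_0_iff by blast
  qed
  ultimately show ?thesis by (simp add: MLD_def proj_degree_eq)
qed

section \<open>The solution of the homaloidal PDE\<close>

definition \<Phi> :: "cmat \<Rightarrow> complex" where
  "\<Phi> S = 4 * (ul (coords S) / Dq (coords S))\<^sup>2"

lemma homogeneous_rational_\<Phi>: "homogeneous_rational \<Phi>"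
proof -
  define p where "p = scalar3 a22 * coord1 + scalar3 a11 * coord3 - scalar3 (2 * a12) * coord2"
  define q where "q = coord1 * coord3 - coord2 * coord2 + p * p"
  have p: "homogeneous 1 p"
    using homogeneous_mult[OF homogeneous_coord(4) homogeneous_coord(1), of a22]
      homogeneous_mult[OF homogeneous_coord(4) homogeneous_coord(3), of a11]
      homogeneous_mult[OF homogeneous_coord(4) homogeneous_coord(2), of "2 * a12"]
    unfolding p_def by (intro homogeneous_add homogeneous_diff) simp_all
  have q: "homogeneous (1 + 1) q"
    unfolding q_def by (intro homogeneous_add homogeneous_diff homogeneous_mult homogeneous_coord p)
  have ep: "ev3 p v = ul v" for v by (simp add: p_def ul_def)
  have eq: "ev3 q v = Dq v" for v by (simp add: q_def ep Dq_def det_form_def power2_eq_square)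
  have "homogeneous (0 + (1 + 1)) (scalar3 4 * (p * p))"
    by (intro homogeneous_mult homogeneous_coord p)
  moreover have "homogeneous ((1 + 1) + (1 + 1)) (q * q)" by (intro homogeneous_mult q)
  moreover have "q * q \<noteq> 0"
  proof
    assume "q * q = 0"
    then have "Dq v = 0" for v using eq[of v] by (simp add: ev3_def)
    then show False using exists_general by auto
  qed
  moreover have "\<Phi> S = peval (scalar3 4 * (p * p)) S / peval (q * q) S" for S
    by (simp add: \<Phi>_def peval_ev3 ep eq power2_eq_square)
  then have "generically (\<lambda>S. \<Phi> S = peval (scalar3 4 * (p * p)) S / peval (q * q) S)"
    by (simp add: generically_general)
  ultimately show ?thesis unfolding homogeneous_rational_def by blast
qed

lemma grad_log_\<Phi>:
  assumes S: "S \<in> Sym" and u0: "ul (coords S) \<noteq> 0" and D0: "Dq (coords S) \<noteq> 0"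
  shows "- grad_log \<Phi> S = sym_mat (mle (coords S))"
proof -
  define u D where "u = ul (coords S)" and "D = Dq (coords S)"
  have nz: "u \<noteq> 0" "D \<noteq> 0" using u0 D0 by (simp_all add: u_def D_def)
  \<comment> \<open>The derivative of log 4 + 2 log u - 2 log D in the direction w.\<close>
  have diff: "1 / \<Phi> S * differential \<Phi> S w = 2 * (u' / u - D' / D)"
    if u': "u' = a22 * w$1$1 + a11 * w$2$2 - 2 * a12 * w$1$2"
      and D': "D' = S$1$1 * w$2$2 + S$2$2 * w$1$1 - 2 * S$1$2 * w$1$2 + 2 * u * u'" for w u' D'
  proof -
    have du: "((\<lambda>t. ul (coords (S + t *\<^sub>c w))) has_field_derivative u') (at 0)"
      unfolding ul_def by (auto intro!: derivative_eq_intros simp: u')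
    have dD: "((\<lambda>t. Dq (coords (S + t *\<^sub>c w))) has_field_derivative D') (at 0)"
      unfolding Dq_def det_form_def
      by (rule derivative_eq_intros du refl | simp)+ (simp add: D' u_def algebra_simps)
    have z: "S + 0 *\<^sub>c w = S" by (simp add: vec_eq_iff)
    have "((\<lambda>t. \<Phi> (S + t *\<^sub>c w)) has_field_derivative
        4 * (2 * (u / D) * ((u' * D - u * D') / (D * D)))) (at 0)"
      unfolding \<Phi>_def
      by (rule derivative_eq_intros du dD refl | simp add: z D0)+ (simp add: u_def D_def z mult_ac)
    then have "differential \<Phi> S w = 4 * (2 * (u / D) * ((u' * D - u * D') / (D * D)))"
      unfolding differential_def by (rule DERIV_imp_deriv)
    then show ?thesis using nz
      by (simp add: \<Phi>_def u_def[symmetric] D_def[symmetric] field_simps power2_eq_square)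
  qed
  have entry: "grad_log \<Phi> S $ i $ j = 1 / (2 - of_bool (i = j)) * (1 / \<Phi> S * differential \<Phi> S (sym_unit i j))"
    for i j
    by (simp add: grad_log_def grad_def)
  have su: "sym_unit i j $ k $ l = (if {k, l} = {i, j} then 1 else 0)" for i j k l
    by (simp add: sym_unit_def)
  note e = entry[unfolded diff[OF refl refl] su]
  have m: "mle (coords S) = (2 / D) *s vector [S$2$2 - (D / u - 2 * u) * a22,
     (D / u - 2 * u) * a12 - S$1$2, S$1$1 - (D / u - 2 * u) * a11]"
    by (simp add: mle_def u_def D_def)
  show ?thesis
    unfolding vec_eq_iff forall_2 uminus_vec_def m
    using nz by (simp add: e doubleton_eq_iff field_simps)
qed

lemma det_mle:
  assumes "S \<in> Sym" "ul (coords S) \<noteq> 0" "Dq (coords S) \<noteq> 0"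
  shows "det (sym_mat (mle (coords S))) = \<Phi> S"
  using mle_props(2)[OF assms] by (simp add: det_Sym \<Phi>_def power_divide power_mult_distrib)

lemma MLE_conic:
  assumes "S \<in> Sym" "ul (coords S) \<noteq> 0" "Dq (coords S) \<noteq> 0"
  shows "MLE (proj_zeros (peval conic)) S = sym_mat (mle (coords S))"
  unfolding MLE_def using fibre[OF assms] by simp

lemma corresponding_solution_\<Phi>: "corresponding_solution (proj_zeros (peval conic)) \<Phi>"
proof -
  have "generically (\<lambda>S. \<Phi> S \<noteq> 0 \<and> \<Phi> S = det (- grad_log \<Phi> S))"
    by (rule generically_general) (simp add: grad_log_\<Phi> det_mle, simp add: \<Phi>_def)
  moreover have "generically (\<lambda>S. MLE (proj_zeros (peval conic)) S = - grad_log \<Phi> S)"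
    by (rule generically_general) (simp add: grad_log_\<Phi> MLE_conic)
  ultimately show ?thesis
    unfolding corresponding_solution_def homaloidal_solution_def
    using MLD_conic homogeneous_rational_\<Phi> by blast
qed

text \<open>The PDE recovers a solution from its own logarithmic gradient, here the MLE, so no
  constant of integration is left.\<close>

lemma corresponding_solution_unique:
  assumes "corresponding_solution (proj_zeros (peval conic)) \<Psi>"
  shows "generically (\<lambda>S. \<Psi> S = \<Phi> S)"
proof -
  have "generically (\<lambda>S. \<Psi> S = det (MLE (proj_zeros (peval conic)) S))"
    using generically_conj[of "\<lambda>S. \<Psi> S \<noteq> 0 \<and> \<Psi> S = det (- grad_log \<Psi> S)"
        "\<lambda>S. MLE (proj_zeros (peval conic)) S = - grad_log \<Psi> S"] assms
    unfolding corresponding_solution_def homaloidal_solution_def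
    by (auto elim: generically_mono)
  moreover have "generically (\<lambda>S. det (MLE (proj_zeros (peval conic)) S) = \<Phi> S)"
    by (rule generically_general) (simp add: MLE_conic det_mle)
  ultimately show ?thesis
    using generically_conj[of "\<lambda>S. \<Psi> S = det (MLE (proj_zeros (peval conic)) S)"
        "\<lambda>S. det (MLE (proj_zeros (peval conic)) S) = \<Phi> S"]
    by (auto elim: generically_mono)
qed

end

theorem corollary4p6:
  shows "(\<forall>X d. irreducible_curve d X \<and> d > 1 \<and> \<not> X \<subseteq> proj_zeros det \<longrightarrow>
            (MLD X = 1 \<longleftrightarrow>
              (\<exists>A\<in>Sym. rank A = 1 \<and> X = proj_zeros (\<lambda>K. det K - (trace (A ** K))\<^sup>2))))
       \<and> (\<forall>A\<in>Sym. rank A = 1 \<longrightarrow>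
            (\<exists>X d. irreducible_curve d X \<and> d > 1 \<and> \<not> X \<subseteq> proj_zeros det \<and> MLD X = 1 \<and>
              X = proj_zeros (\<lambda>K. det K - (trace (A ** K))\<^sup>2)))
       \<and> (\<forall>X d. \<forall>A\<in>Sym. irreducible_curve d X \<and> d > 1 \<and> \<not> X \<subseteq> proj_zeros det \<and> rank A = 1 \<and>
            X = proj_zeros (\<lambda>K. det K - (trace (A ** K))\<^sup>2) \<longrightarrow>
            (let \<Phi> = (\<lambda>S::cmat.
                 4 * ((A$2$2 * S$1$1 + A$1$1 * S$2$2 - 2 * A$1$2 * S$1$2) /
                      ((S$1$1 * S$2$2 - (S$1$2)\<^sup>2)
                       + (A$2$2 * S$1$1 + A$1$1 * S$2$2 - 2 * A$1$2 * S$1$2)\<^sup>2))\<^sup>2)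
             in corresponding_solution X \<Phi> \<and>
                (\<forall>\<Psi>. corresponding_solution X \<Psi> \<longrightarrow> generically (\<lambda>S. \<Psi> S = \<Phi> S))))"
proof (intro conjI allI ballI impI)
  fix X d assume X: "irreducible_curve d X \<and> d > 1 \<and> \<not> X \<subseteq> proj_zeros det"
  then obtain f where f: "irreducible f" "homogeneous d f" "X = proj_zeros (peval f)"
    unfolding irreducible_curve_def by blast
  obtain a where "has_gradient (ev3 f) a" using polyfun_has_gradient[OF polyfun_ev3] by blast
  then interpret plane_curve f d X a using X f by unfold_locales auto
  show "MLD X = 1 \<longleftrightarrow>
      (\<exists>A\<in>Sym. rank A = 1 \<and> X = proj_zeros (\<lambda>K. det K - (trace (A ** K))\<^sup>2))"
  proof
    assume "\<exists>A\<in>Sym. rank A = 1 \<and> X = proj_zeros (\<lambda>K. det K - (trace (A ** K))\<^sup>2)"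
    then obtain A where A: "A \<in> Sym" "rank A = 1"
      and XA: "X = proj_zeros (\<lambda>K. det K - (trace (A ** K))\<^sup>2)" by blast
    interpret R: rank_one A using A by unfold_locales
    show "MLD X = 1" unfolding XA R.conic_zeros by (rule R.MLD_conic)
  qed (rule MLD_1_imp_conic)
next
  fix A :: cmat assume A: "A \<in> Sym" "rank A = 1"
  then interpret rank_one A by unfold_locales
  have "irreducible_curve 2 (proj_zeros (peval conic))"
    unfolding irreducible_curve_def using irreducible_conic homogeneous_conic by blast
  then show "\<exists>X d. irreducible_curve d X \<and> d > 1 \<and> \<not> X \<subseteq> proj_zeros det \<and> MLD X = 1 \<and>
      X = proj_zeros (\<lambda>K. det K - (trace (A ** K))\<^sup>2)"
    unfolding conic_zeros using conic_not_in_det MLD_conic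
    by (intro exI[of _ "proj_zeros (peval conic)"] exI[of _ 2]) simp
next
  fix X d and A :: cmat
  assume A: "A \<in> Sym" and curve: "irreducible_curve d X \<and> d > 1 \<and> \<not> X \<subseteq> proj_zeros det \<and> rank A = 1 \<and>
      X = proj_zeros (\<lambda>K. det K - (trace (A ** K))\<^sup>2)"
  then interpret rank_one A by unfold_locales blast+
  have XA: "X = proj_zeros (peval conic)"
    using curve conic_zeros by simp
  have "\<Phi> = (\<lambda>S. 4 * ((a22 * S$1$1 + a11 * S$2$2 - 2 * a12 * S$1$2) /
      ((S$1$1 * S$2$2 - (S$1$2)\<^sup>2) + (a22 * S$1$1 + a11 * S$2$2 - 2 * a12 * S$1$2)\<^sup>2))\<^sup>2)"
    unfolding \<Phi>_def[abs_def] ul_def Dq_def det_form_def coords_nth power2_eq_square by (rule refl)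
  note \<Phi>_eq = this[symmetric]
  show "let \<Phi> = (\<lambda>S::cmat.
           4 * ((A$2$2 * S$1$1 + A$1$1 * S$2$2 - 2 * A$1$2 * S$1$2) /
                ((S$1$1 * S$2$2 - (S$1$2)\<^sup>2)
                 + (A$2$2 * S$1$1 + A$1$1 * S$2$2 - 2 * A$1$2 * S$1$2)\<^sup>2))\<^sup>2)
       in corresponding_solution X \<Phi> \<and>
          (\<forall>\<Psi>. corresponding_solution X \<Psi> \<longrightarrow> generically (\<lambda>S. \<Psi> S = \<Phi> S))"
    unfolding Let_def \<Phi>_eq XA
    using corresponding_solution_\<Phi> corresponding_solution_unique by blast
qed

end
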